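(* Let $q,p\in(0,2]$ and, for $\lambda>0$, $\Phi_\lambda(U,V)=F(UV^T)+\frac\lambda q\|U\|_{2,q}^q+\frac\lambda p\|V\|_{2,p}^p$ on $\mathbb{R}^{m\times d}\times\mathbb{R}^{n\times d}$. Let $\{(U^k,V^k)\}_{k\ge0}$ be an infinite sequence generated by the inexact proximal alternating linearized minimization method (described in the context) with tolerances satisfying $\sum_{k=0}^\infty\sqrt{\delta_k}<+\infty$. Assume: (A1) $F$ is continuously differentiable, proper and bounded below; (A2) $\Phi_{\lambda_0}$ has a critical point; (A3) $\nabla F^k$ and $\nabla\bar F^k$ are Lipschitz continuous with constants $L_1^k/2$ and $L_2^k/2$ respectively, and there are constants $0<l<L<+\infty$ with $l\le L_1^k,L_2^k\le L$ for all $k$; (C) the weights $\beta_k$ are such that $\Phi_\lambda^{k+1}(U^{k+1},V^{k+1})\le\Phi_\lambda^{k+1}(U^k,V^k)$, and there is $\delta_\beta<1$ such that $0\le\beta_k\le\frac16\delta_\beta\min\left\{\sqrt{L_1^{k-1}/L_1^k},\sqrt{L_2^{k-1}/L_2^k}\right\}$ uniformly over all $k$. Let $(\bar U,\bar V)$ be a limit point of $\{(U^k,V^k)\}$ and suppose that: 1. $\nabla_UF(U,V)$ and $\nabla_VF(U,V)$ are Lipschitz continuous with respect to $(U,V)$ within the ball $\mathbb{B}_{4\rho}((\bar U,\bar V))$; 2. there is a sufficiently large $K$ such that for all $k\ge K$, $$\Phi_\lambda^k(U^k,V^k)-\Phi_\lambda^k(\bar U,\bar V)\ge\Phi_\lambda^{k+1}(U^{k+1},V^{k+1})-\Phi_\lambda^{k+1}(\bar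 U,\bar V)>0;$$ 3. there is a sufficiently large $K$ such that for all $k\ge K$, $\Phi_\lambda^k$ has the KL property at $(\bar U,\bar V)$ with the same function $\varphi(s)=\mu s^{1-\theta}$ and the same parameters $\rho,\eta,\theta,\mu$ (the same $\rho$ as in condition 1). Then $\{(U^k,V^k)\}$ converges to $(\bar U,\bar V)$, which is a critical point of $\Phi_{\lambda_0}$.
   Context: Notation: $A_t=A_{:,t}$ is the $t$-th column of $A$; $\|A\|_{2,q}^q=\sum_t\|A_t\|_2^q$; $F(U,V):=F(UV^T)$; $F^k(U)=F(U,V^k)$, $\bar F^k(V)=F(U^{k+1},V)$; $\operatorname{prox}_h(x)=\arg\min_y\frac12\|y-x\|^2+h(y)$; $\partial$ is the limiting Fréchet subdifferential, and a critical point of $\Phi$ is a point with $0\in\partial\Phi$. Algorithm (inexact proximal alternating linearized minimization). Choose $\lambda^0>\lambda_0>0$, $\varrho\in(0,1)$, a bound $\beta^*\geq 0$, step parameters $L_1^k,L_2^k>0$, tolerances $\delta_k\in[0,\frac14]$ with $\delta_k\to0$ and $\sum_k\delta_k<\infty$, and $(U^{-1},V^{-1})=(U^0,V^0)$. At iteration $k\geq 0$, with extrapolation weight $\beta_k\in[0,\beta^*]$, put $\widetilde U^k=U^k+\beta_k(U^k-U^{k-1})$, $\widetilde V^k=V^k+\beta_k(V^k-V^{k-1})$. First $U^{k+1}$ is a (possibly inexact) minimizer over $U$ of $\langle\nabla F^k(\widetilde U^k),U-\widetilde U^k\rangle+\frac{L_1^k}2\|U-\widetilde U^k\|_F^2+\frac{\lambda^k}q\|U\|_{2,q}^q$,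 then $V^{k+1}$ is a (possibly inexact) minimizer over $V$ of $\langle\nabla\bar F^k(\widetilde V^k),V-\widetilde V^k\rangle+\frac{L_2^k}2\|V-\widetilde V^k\|_F^2+\frac{\lambda^k}p\|V\|_{2,p}^p$. Inexactness with tolerance $\delta_k$ means that there are $\lambda_{1,t}^k,\lambda_{2,t}^k>0$ ($t=1,\dots,d$) with $$U_t^{k+1}\in\operatorname{prox}_{\frac{\lambda_{1,t}^k}{qL_1^k}\|\cdot\|_2^q}\left(\left(\widetilde U^k-\tfrac1{L_1^k}\nabla F^k(\widetilde U^k)\right)_t\right),\qquad V_t^{k+1}\in\operatorname{prox}_{\frac{\lambda_{2,t}^k}{pL_2^k}\|\cdot\|_2^p}\left(\left(\widetilde V^k-\tfrac1{L_2^k}\nabla\bar F^k(\widetilde V^k)\right)_t\right),$$ $$\left|\left(\lambda^k/\lambda_{1,t}^k\right)^{\frac1{q+1}}-1\right|\le\delta_k,\qquad\left|\left(\lambda^k/\lambda_{2,t}^k\right)^{\frac1{p+1}}-1\right|\le\delta_k$$ (exact solution: $\lambda_{i,t}^k=\lambda^k$). Then $\lambda^{k+1}=\max\{\varrho\lambda^k,\lambda_0\}$. Rank adjustment: zero columns of $U^{k+1}$ or $V^{k+1}$ are removed (same column indices in all iterates in use) and $d$ is decreased; this happens only finitely often, and statements about the sequence refer to iterates after $d$ has become constant. The stopping test is disregarded. Perturbed objective: $\Phi_\lambda^{k+1}(U,V)=F(UV^T)+\sum_{t=1}^d\frac{\lambda_{1,t}^k}q\|U_t\|_2^q+\sum_{t=1}^d\frac{\lambda_{2,t}^k}p\|V_t\|_2^p$.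 KL property of $f$ at $\bar x$ with parameters $\rho>0$, $\eta\in(0,+\infty]$, $\theta\in[0,1)$, $\mu>0$: with $\varphi(s)=\mu s^{1-\theta}$, $\varphi'(f(x)-f(\bar x))\operatorname{dist}(0,\partial f(x))\ge1$ for every $x$ with $\|x-\bar x\|_2\le\rho$ and $f(\bar x)<f(x)<f(\bar x)+\eta$. $\mathbb{B}_{4\rho}(\bar x)$ is the ball of radius $4\rho$ about $\bar x$. *)

theory Defs
  imports "HOL-Analysis.Analysis"
begin

section \<open>Variational analysis\<close>

text \<open>Only meaningful where \<open>f\<close> is differentiable; the gradient is then unique.\<close>

definition gradient :: "('a::real_inner \<Rightarrow> real) \<Rightarrow> 'a \<Rightarrow> 'a" where
  "gradient f x = (THE D. GDERIV f x :> D)"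

definition continuously_differentiable :: "('a::real_inner \<Rightarrow> real) \<Rightarrow> bool" where
  "continuously_differentiable f \<longleftrightarrow>
     (\<exists>f'. (\<forall>x. GDERIV f x :> f' x) \<and> continuous_on UNIV f')"

definition prox :: "('a::real_inner \<Rightarrow> real) \<Rightarrow> 'a \<Rightarrow> 'a set" where
  "prox h x = {z. is_arg_min (\<lambda>y. 1 / 2 * (norm (y - x))\<^sup>2 + h y) (\<lambda>_. True) z}"

definition frechet_subdiff :: "('a::real_inner \<Rightarrow> real) \<Rightarrow> 'a \<Rightarrow> 'a set" where
  "frechet_subdiff f x =
     {v. 0 \<le> Liminf (at x) (\<lambda>y. ereal ((f y - f x - v \<bullet> (y - x)) / norm (y - x)))}"

definition limiting_subdiff :: "('a::real_inner \<Rightarrow> real) \<Rightarrow> 'a \<Rightarrow> 'a set" where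
  "limiting_subdiff f x =
     {v. \<exists>X V. X \<longlonglongrightarrow> x \<and> (\<lambda>j. f (X j)) \<longlonglongrightarrow> f x \<and>
               (\<forall>j. V j \<in> frechet_subdiff f (X j)) \<and> V \<longlonglongrightarrow> v}"

definition critical_point :: "('a::real_inner \<Rightarrow> real) \<Rightarrow> 'a \<Rightarrow> bool" where
  "critical_point f x \<longleftrightarrow> 0 \<in> limiting_subdiff f x"

text \<open>The distance to the empty set is \<open>\<infinity>\<close> here, in contrast to \<^const>\<open>infdist\<close>
  and \<^const>\<open>setdist\<close>.\<close>

definition edist_to :: "'a::metric_space \<Rightarrow> 'a set \<Rightarrow> ereal" where
  "edist_to x S = (INF v\<in>S. ereal (dist x v))"

definition KL_property ::
  "('a::real_inner \<Rightarrow> real) \<Rightarrow> 'a \<Rightarrow> real \<Rightarrow> ereal \<Rightarrow> real \<Rightarrow> real \<Rightarrow> bool" where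
  "KL_property f xb \<rho> \<eta> \<theta> \<mu> \<longleftrightarrow>
     0 < \<rho> \<and> 0 < \<eta> \<and> 0 \<le> \<theta> \<and> \<theta> < 1 \<and> 0 < \<mu> \<and>
     (\<forall>x. norm (x - xb) \<le> \<rho> \<and> f xb < f x \<and> ereal (f x) < ereal (f xb) + \<eta> \<longrightarrow>
        1 \<le> ereal (deriv (\<lambda>s. \<mu> * s powr (1 - \<theta>)) (f x - f xb)) * edist_to 0 (limiting_subdiff f x))"

section \<open>The objective functions\<close>

text \<open>On \<^typ>\<open>real ^ 'd ^ 'm\<close> and on products of such types the library's \<^const>\<open>norm\<close> and
  inner product are the Frobenius ones.\<close>

definition norm_2q_powr :: "real \<Rightarrow> real ^ 'd ^ 'm \<Rightarrow> real" where
  "norm_2q_powr q A = (\<Sum>t\<in>UNIV. norm (column t A) powr q)"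

definition grad_U ::
  "(real ^ 'n ^ 'm \<Rightarrow> real) \<Rightarrow> real ^ 'd ^ 'm \<Rightarrow> real ^ 'd ^ 'n \<Rightarrow> real ^ 'd ^ 'm" where
  "grad_U F U V = gradient (\<lambda>X. F (X ** transpose V)) U"

definition grad_V ::
  "(real ^ 'n ^ 'm \<Rightarrow> real) \<Rightarrow> real ^ 'd ^ 'm \<Rightarrow> real ^ 'd ^ 'n \<Rightarrow> real ^ 'd ^ 'n" where
  "grad_V F U V = gradient (\<lambda>Y. F (U ** transpose Y)) V"

definition Phi ::
  "(real ^ 'n ^ 'm \<Rightarrow> real) \<Rightarrow> real \<Rightarrow> real \<Rightarrow> real \<Rightarrow> (real ^ 'd ^ 'm) \<times> (real ^ 'd ^ 'n) \<Rightarrow> real" where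
  "Phi F q p c = (\<lambda>(U, V).
     F (U ** transpose V) + c / q * norm_2q_powr q U + c / p * norm_2q_powr p V)"

definition Phi_weighted ::
  "(real ^ 'n ^ 'm \<Rightarrow> real) \<Rightarrow> real \<Rightarrow> real \<Rightarrow> ('d \<Rightarrow> real) \<Rightarrow> ('d \<Rightarrow> real) \<Rightarrow>
     (real ^ 'd ^ 'm) \<times> (real ^ 'd ^ 'n) \<Rightarrow> real" where
  "Phi_weighted F q p w1 w2 = (\<lambda>(U, V).
     F (U ** transpose V) + (\<Sum>t\<in>UNIV. w1 t / q * norm (column t U) powr q)
       + (\<Sum>t\<in>UNIV. w2 t / p * norm (column t V) powr p))"

text \<open>The perturbed objective with superscript \<open>k\<close> uses the column weights of iteration
  \<open>k - 1\<close>; it is only used for \<open>k \<ge> 1\<close>.\<close>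

definition Phi_pert ::
  "(real ^ 'n ^ 'm \<Rightarrow> real) \<Rightarrow> real \<Rightarrow> real \<Rightarrow> (nat \<Rightarrow> 'd \<Rightarrow> real) \<Rightarrow> (nat \<Rightarrow> 'd \<Rightarrow> real) \<Rightarrow> nat \<Rightarrow>
     (real ^ 'd ^ 'm) \<times> (real ^ 'd ^ 'n) \<Rightarrow> real" where
  "Phi_pert F q p lam1 lam2 k = Phi_weighted F q p (lam1 (k - 1)) (lam2 (k - 1))"

section \<open>The algorithm\<close>

text \<open>\<open>X (k - 1)\<close> is \<open>X 0\<close> for \<open>k = 0\<close>, which is the convention that the iterate with index
  \<open>-1\<close> equals the one with index \<open>0\<close>.\<close>

definition extrapolate :: "(nat \<Rightarrow> real) \<Rightarrow> (nat \<Rightarrow> 'a::real_vector) \<Rightarrow> nat \<Rightarrow> 'a" where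
  "extrapolate bet X k = X k + bet k *\<^sub>R (X k - X (k - 1))"

text \<open>\<open>N\<close> is an iteration from which on the number \<open>d = CARD('d)\<close> of columns is constant, with
  \<open>N = 0\<close> if no column is ever removed. The scalar parameters are those of the entire run. The
  matrices \<open>U k\<close>, \<open>V k\<close> and the column weights carry information from iteration \<open>N\<close> on (which
  also reads \<open>U (N - 1)\<close>, \<open>V (N - 1)\<close>, reduced to the remaining columns); their values at
  earlier indices are irrelevant. As no column is removed any more, the columns of the new
  iterates are nonzero; the starting point \<open>U 0\<close>, \<open>V 0\<close> itself may have zero columns.\<close>

definition ipalm_run ::
  "(real ^ 'n ^ 'm \<Rightarrow> real) \<Rightarrow> real \<Rightarrow> real \<Rightarrow> real \<Rightarrow> real \<Rightarrow> real \<Rightarrow>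
   (nat \<Rightarrow> real) \<Rightarrow> (nat \<Rightarrow> real) \<Rightarrow> (nat \<Rightarrow> real) \<Rightarrow> (nat \<Rightarrow> real) \<Rightarrow> (nat \<Rightarrow> real) \<Rightarrow>
   (nat \<Rightarrow> 'd \<Rightarrow> real) \<Rightarrow> (nat \<Rightarrow> 'd \<Rightarrow> real) \<Rightarrow> nat \<Rightarrow>
   (nat \<Rightarrow> real ^ 'd ^ 'm) \<Rightarrow> (nat \<Rightarrow> real ^ 'd ^ 'n) \<Rightarrow> bool" where
  "ipalm_run F q p lam0 varrho betmax lam del L1 L2 bet lam1 lam2 N U V \<longleftrightarrow>
     0 < lam0 \<and> lam0 < lam 0 \<and> 0 < varrho \<and> varrho < 1 \<and>
     (\<forall>k. lam (k + 1) = max (varrho * lam k) lam0) \<and>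
     (\<forall>k. 0 \<le> del k \<and> del k \<le> 1 / 4) \<and> del \<longlonglongrightarrow> 0 \<and> summable del \<and>
     (\<forall>k. 0 < L1 k \<and> 0 < L2 k) \<and>
     0 \<le> betmax \<and> (\<forall>k. 0 \<le> bet k \<and> bet k \<le> betmax) \<and>
     (\<forall>k\<ge>N. \<forall>t.
        0 < lam1 k t \<and> 0 < lam2 k t \<and>
        column t (U (k + 1)) \<in>
          prox (\<lambda>x. lam1 k t / (q * L1 k) * norm x powr q)
            (column t (extrapolate bet U k
               - (1 / L1 k) *\<^sub>R grad_U F (extrapolate bet U k) (V k))) \<and>
        column t (V (k + 1)) \<in>
          prox (\<lambda>x. lam2 k t / (p * L2 k) * norm x powr p)
            (column t (extrapolate bet V k
               - (1 / L2 k) *\<^sub>R grad_V F (U (k + 1)) (extrapolate bet V k))) \<and>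
        \<bar>(lam k / lam1 k t) powr (1 / (q + 1)) - 1\<bar> \<le> del k \<and>
        \<bar>(lam k / lam2 k t) powr (1 / (p + 1)) - 1\<bar> \<le> del k) \<and>
     (\<forall>k\<ge>N. 0 < k \<longrightarrow> (\<forall>t. column t (U k) \<noteq> 0 \<and> column t (V k) \<noteq> 0))"

end

theory Submission
  imports Defs
begin

text \<open>
  All columns of the iterates are nonzero, so the perturbed objective is differentiable
  along the run. Comparing the prox subproblems with the previous iterate gives
  \<open>A (k + 1) \<le> \<delta>\<^sub>\<beta>\<^sup>2 A k + e k + r (k + 1) - r (k + 2)\<close>, where \<open>A k\<close> is the weighted squared length of the
  \<open>k\<close>-th step, \<open>r k > 0\<close> is the gap of the perturbed objective to its value at the limit point, and
  \<open>e k\<close> is a multiple of \<open>\<delta>\<^sub>k + \<delta>\<^sub>k\<^sub>+\<^sub>1\<close> that pays for the change of the weights. Optimality in the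
  subproblems bounds the gradient by \<open>sqrt (A (k + 1)) + sqrt (A k)\<close>. Taking roots and using the KL
  inequality yields, as long as the iterates stay near the limit point,
  \<open>c * sqrt (A (k + 1)) \<le> E k - E (k + 1)\<close> for a potential \<open>E\<close> that tends to \<open>0\<close>; the step lengths
  then telescope, and the iterates, once close to the limit point, never leave its neighbourhood.
\<close>

section \<open>Gradients\<close>

lemma GDERIV_imp_gradient:
  assumes "GDERIV f x :> D"
  shows "gradient f x = D"
proof -
  have "E = D" if "GDERIV f x :> E" for E
  proof -
    have "(\<lambda>h. h \<bullet> E) = (\<lambda>h. h \<bullet> D)"
      using that assms unfolding gderiv_def by (rule has_derivative_unique)
    then have "(E - D) \<bullet> (E - D) = 0"
      by (auto dest: fun_cong[where x = "E - D"] simp: inner_diff_right)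
    then show ?thesis by simp
  qed
  then show ?thesis
    unfolding gradient_def using assms by blast
qed

lemma differentiable_imp_GDERIV:
  fixes f :: "'a::euclidean_space \<Rightarrow> real"
  assumes "f differentiable at x"
  shows "GDERIV f x :> gradient f x"
proof -
  obtain f' where f': "(f has_derivative f') (at x)"
    using assms by (auto simp: differentiable_def)
  then have lin: "linear f'"
    using bounded_linear.linear has_derivative_bounded_linear by blast
  define D where "D = (\<Sum>b\<in>Basis. f' b *\<^sub>R b)"
  have "f' = (\<lambda>h. h \<bullet> D)"
  proof
    fix h
    have "f' h = f' (\<Sum>b\<in>Basis. (h \<bullet> b) *\<^sub>R b)"
      by (simp add: euclidean_representation)
    also have "\<dots> = (\<Sum>b\<in>Basis. (h \<bullet> b) * f' b)"
      using lin by (simp add: linear_sum linear_scale)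
    also have "\<dots> = h \<bullet> D"
      unfolding D_def inner_sum_right by (simp add: inner_commute mult.commute)
    finally show "f' h = h \<bullet> D" .
  qed
  then have "GDERIV f x :> D"
    using f' by (simp add: gderiv_def)
  with GDERIV_imp_gradient[OF this] show ?thesis by simp
qed

text \<open>The descent lemma. Along the segment from \<open>x\<close> to \<open>y\<close>,
  \<open>\<psi>\<close> is \<open>f\<close> minus its linear part and the quadratic bound; the
  Lipschitz property makes its derivative nonpositive, so
  \<open>\<psi> 1 \<le> \<psi> 0\<close>.\<close>

lemma lipschitz_gradient_upper_bound:
  fixes f :: "'a::real_inner \<Rightarrow> real"
  assumes f: "\<And>x. GDERIV f x :> g x" and g: "C-lipschitz_on UNIV g"
  shows "f y \<le> f x + g x \<bullet> (y - x) + C / 2 * (norm (y - x))\<^sup>2"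
proof -
  define h where "h = y - x"
  define \<psi> where "\<psi> t = f (x + t *\<^sub>R h) - t * (g x \<bullet> h) - C / 2 * t\<^sup>2 * (norm h)\<^sup>2" for t
  have D: "(\<psi> has_real_derivative g (x + t *\<^sub>R h) \<bullet> h - g x \<bullet> h - C * t * (norm h)\<^sup>2) (at t)" for t
  proof -
    have 1: "((\<lambda>t. x + t *\<^sub>R h) has_derivative (\<lambda>s. s *\<^sub>R h)) (at t)"
      by (auto intro!: derivative_eq_intros)
    have "((\<lambda>t. f (x + t *\<^sub>R h)) has_derivative (\<lambda>s. (s *\<^sub>R h) \<bullet> g (x + t *\<^sub>R h))) (at t)"
      using has_derivative_compose[OF 1 f[of "x + t *\<^sub>R h", unfolded gderiv_def]] by simp
    then have "((\<lambda>t. f (x + t *\<^sub>R h)) has_real_derivative g (x + t *\<^sub>R h) \<bullet> h) (at t)"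
      by (simp add: has_field_derivative_def mult_commute_abs inner_commute)
    then show ?thesis
      unfolding \<psi>_def by (auto intro!: derivative_eq_intros)
  qed
  have "g (x + t *\<^sub>R h) \<bullet> h - g x \<bullet> h - C * t * (norm h)\<^sup>2 \<le> 0" if "0 \<le> t" for t
  proof -
    have "g (x + t *\<^sub>R h) \<bullet> h - g x \<bullet> h = (g (x + t *\<^sub>R h) - g x) \<bullet> h"
      by (simp add: inner_diff_left)
    also have "\<dots> \<le> norm (g (x + t *\<^sub>R h) - g x) * norm h"
      by (rule norm_cauchy_schwarz)
    also have "\<dots> \<le> (C * norm (t *\<^sub>R h)) * norm h"
      using lipschitz_onD[OF g, of "x + t *\<^sub>R h" x]
      by (intro mult_right_mono) (auto simp: dist_norm)
    also have "\<dots> = C * t * (norm h)\<^sup>2"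
      using that by (simp add: power2_eq_square)
    finally show ?thesis by simp
  qed
  then have "\<exists>y. (\<psi> has_real_derivative y) (at t) \<and> y \<le> 0" if "0 \<le> t" for t
    using D[of t] that by (intro exI conjI)
  then have "\<psi> 1 \<le> \<psi> 0"
    by (intro DERIV_nonpos_imp_nonincreasing[of 0 1 \<psi>]) auto
  then show ?thesis by (simp add: \<psi>_def h_def)
qed

lemma GDERIV_in_limiting_subdiff:
  fixes f :: "'a::real_inner \<Rightarrow> real"
  assumes "GDERIV f x :> D"
  shows "D \<in> frechet_subdiff f x" "D \<in> limiting_subdiff f x"
proof -
  show *: "D \<in> frechet_subdiff f x"
  proof (cases "at x = bot")
    \<comment> \<open>Only a one-point space is affected: there \<open>at x\<close> is the trivial
      filter, over which the \<open>Liminf\<close> is \<infinity>.\<close>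
    case True
    then show ?thesis by (simp add: frechet_subdiff_def)
  next
    case False
    have "((\<lambda>y. (f y - f x - D \<bullet> (y - x)) / norm (y - x)) \<longlongrightarrow> 0) (at x)"
      using assms unfolding gderiv_def has_derivative_at2
      by (simp add: divide_inverse mult.commute[of "inverse _"] inner_commute[of D] diff_diff_eq)
    then have "((\<lambda>y. ereal ((f y - f x - D \<bullet> (y - x)) / norm (y - x))) \<longlongrightarrow> ereal 0) (at x)"
      by (rule tendsto_ereal)
    then have "Liminf (at x) (\<lambda>y. ereal ((f y - f x - D \<bullet> (y - x)) / norm (y - x))) = ereal 0"
      by (rule lim_imp_Liminf[OF False])
    then show ?thesis by (simp add: frechet_subdiff_def)
  qed
  then show "D \<in> limiting_subdiff f x"
    unfolding limiting_subdiff_def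
    by (intro CollectI exI[of _ "\<lambda>_. x"] exI[of _ "\<lambda>_. D"]) auto
qed

section \<open>Convergence under the Kurdyka-Lojasiewicz property\<close>

text \<open>By the mean value theorem the difference quotient is
  \<open>(1 - \<theta>) * z powr - \<theta>\<close> at some \<open>z\<close> between
  \<open>t\<close> and \<open>s\<close>, and this factor decreases in \<open>z\<close>.\<close>

lemma powr_concave_diff:
  fixes s t \<theta> :: real
  assumes "0 < t" "t \<le> s" "0 \<le> \<theta>" "\<theta> < 1"
  shows "(1 - \<theta>) * s powr - \<theta> * (s - t) \<le> s powr (1 - \<theta>) - t powr (1 - \<theta>)"
proof (cases "t = s")
  case False
  then have "t < s" using assms by simp
  then obtain z where z: "t < z" "z < s"
      "s powr (1 - \<theta>) - t powr (1 - \<theta>) = (s - t) * ((1 - \<theta>) * z powr (1 - \<theta> - 1))"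
    using MVT2[of t s "\<lambda>x. x powr (1 - \<theta>)" "\<lambda>z. (1 - \<theta>) * z powr (1 - \<theta> - 1)"]
      has_real_derivative_powr[of _ "1 - \<theta>"] assms by force
  have "s powr - \<theta> \<le> z powr - \<theta>"
    using z assms by (intro powr_mono2') auto
  then have "(1 - \<theta>) * (s - t) * s powr - \<theta> \<le> (1 - \<theta>) * (s - t) * z powr - \<theta>"
    using assms by (intro mult_left_mono) auto
  then show ?thesis using z by (simp add: mult_ac)
qed simp

text \<open>Concavity of the desingularizing function turns the KL inequality into a bound of the
  decrease from \<open>f x - f xb\<close> to \<open>t\<close> by the decrease of the desingularizing function.\<close>

lemma KL_decrease:
  fixes f :: "'a::real_inner \<Rightarrow> real"
  assumes KL: "KL_property f xb \<rho> \<eta> \<theta> \<mu>"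
    and x: "norm (x - xb) \<le> \<rho>" "f xb < f x" "ereal (f x - f xb) < \<eta>"
    and t: "0 < t" "t \<le> f x - f xb"
    and w: "w \<in> limiting_subdiff f x"
  shows "f x - f xb - t \<le> \<mu> * ((f x - f xb) powr (1 - \<theta>) - t powr (1 - \<theta>)) * norm w"
proof -
  define s where "s = f x - f xb"
  have pars: "0 \<le> \<theta>" "\<theta> < 1" "0 < \<mu>" and s: "0 < s" "t \<le> s"
    using KL x t by (auto simp: KL_property_def s_def)
  have "((\<lambda>s. \<mu> * s powr (1 - \<theta>)) has_real_derivative \<mu> * ((1 - \<theta>) * s powr (1 - \<theta> - 1))) (at s)"
    using s by (intro DERIV_cmult has_real_derivative_powr)
  then have deriv: "deriv (\<lambda>s. \<mu> * s powr (1 - \<theta>)) s = \<mu> * (1 - \<theta>) * s powr - \<theta>"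
    by (auto dest: DERIV_imp_deriv)
  have "ereal (f x) < ereal (f xb) + \<eta>"
    using x(3) by (cases \<eta>) auto
  then have "1 \<le> ereal (\<mu> * (1 - \<theta>) * s powr - \<theta>) * edist_to 0 (limiting_subdiff f x)"
    using KL x by (auto simp: KL_property_def s_def deriv[unfolded s_def])
  \<comment> \<open>The distance is an infimum, so every limiting subgradient \<open>w\<close>
    bounds it from above and the KL inequality bounds \<open>norm w\<close> from below.\<close>
  also have "\<dots> \<le> ereal (\<mu> * (1 - \<theta>) * s powr - \<theta>) * ereal (norm w)"
    using pars w unfolding edist_to_def
    by (intro ereal_mult_left_mono) (auto intro: INF_lower2)
  finally have 1: "1 \<le> \<mu> * (1 - \<theta>) * s powr - \<theta> * norm w"
    by (simp add: one_ereal_def)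
  have "(s - t) * 1 \<le> (s - t) * (\<mu> * (1 - \<theta>) * s powr - \<theta> * norm w)"
    using 1 s by (intro mult_left_mono) auto
  also have "\<dots> = (\<mu> * norm w) * ((1 - \<theta>) * s powr - \<theta> * (s - t))"
    by simp
  also have "\<dots> \<le> (\<mu> * norm w) * (s powr (1 - \<theta>) - t powr (1 - \<theta>))"
    using powr_concave_diff[OF t(1) s(2) pars(1,2)] pars by (intro mult_left_mono) auto
  finally show ?thesis by (simp add: s_def mult_ac)
qed

text \<open>Summing the recursion bounds \<open>(1 - c)\<close> times every partial sum of
  \<open>x\<close>, so \<open>x\<close> is even summable.\<close>

lemma contraction_with_summable_error_tendsto_0:
  fixes x u :: "nat \<Rightarrow> real"
  assumes "\<And>k. 0 \<le> x k" "c < 1" "summable u" "\<And>k. 0 \<le> u k"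
    and step: "\<And>k. x (Suc k) \<le> c * x k + u k"
  shows "x \<longlonglongrightarrow> 0"
proof -
  have part: "(1 - c) * (\<Sum>k<n. x k) \<le> x 0 - x n + (\<Sum>k<n. u k)" for n
  proof (induction n)
    case (Suc n)
    then show ?case using step[of n] by (simp add: algebra_simps)
  qed simp
  have "(1 - c) * (\<Sum>k<n. x k) \<le> x 0 + suminf u" for n
  proof -
    have "(\<Sum>k<n. u k) \<le> suminf u"
      using assms by (intro sum_le_suminf) auto
    then show ?thesis using part[of n] assms(1)[of n] by simp
  qed
  then have "(\<Sum>k<n. x k) \<le> (x 0 + suminf u) / (1 - c)" for n
    using assms(2) by (simp add: field_simps)
  then have "summable x"
    using assms(1) by (intro summableI_nonneg_bounded) auto
  then show ?thesis by (rule summable_LIMSEQ_zero)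
qed

text \<open>A trapping argument: steps are controlled by the potential only inside the ball. From an
  iterate near \<open>zb\<close> at which the potential is already small, the remaining path is too
  short to leave the ball, so the control never ends.\<close>

lemma convergent_to_limit_point_by_potential:
  fixes z :: "nat \<Rightarrow> 'a::metric_space"
  assumes "0 < \<rho>" "0 \<le> c"
    and E: "\<And>k. 0 \<le> E k" "E \<longlonglongrightarrow> 0"
    and steps: "(\<lambda>k. dist (z (Suc k)) (z k)) \<longlonglongrightarrow> 0"
    and bound: "\<And>k. \<lbrakk>dist (z k) zb \<le> \<rho>; dist (z (Suc k)) zb \<le> \<rho>\<rbrakk>
                  \<Longrightarrow> dist (z (Suc k)) (z k) \<le> c * (E k - E (Suc k))"
    and lim: "\<And>e n. 0 < e \<Longrightarrow> \<exists>k\<ge>n. dist (z k) zb < e"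
  shows "z \<longlonglongrightarrow> zb"
proof (rule metric_LIMSEQ_I)
  fix e :: real
  assume "0 < e"
  \<comment> \<open>One third each for the distance of the starting iterate, for the path travelled
    since then, and for a single further step.\<close>
  define \<epsilon> where "\<epsilon> = min e \<rho> / 3"
  have \<epsilon>: "0 < \<epsilon>" "3 * \<epsilon> \<le> e" "3 * \<epsilon> \<le> \<rho>"
    using \<open>0 < e\<close> \<open>0 < \<rho>\<close> by (auto simp: \<epsilon>_def)
  have cE: "(\<lambda>k. c * E k) \<longlonglongrightarrow> 0"
    using tendsto_mult_left[OF E(2), of c] by simp
  obtain k1 where k1: "\<And>k. k \<ge> k1 \<Longrightarrow> c * E k < \<epsilon> \<and> dist (z (Suc k)) (z k) < \<epsilon>"
    using eventually_conj[OF order_tendstoD(2)[OF cE \<epsilon>(1)] order_tendstoD(2)[OF steps \<epsilon>(1)]]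
    by (auto simp: eventually_sequentially)
  obtain K where K: "dist (z K) zb < \<epsilon>" "k1 \<le> K"
    using lim[OF \<epsilon>(1)] by blast
  have main: "dist (z k) zb \<le> \<epsilon> + c * (E K - E k)" if "k \<ge> K" for k
    using that
  proof (induction k rule: dec_induct)
    case base
    then show ?case using K by simp
  next
    case (step k)
    have "c * E K < \<epsilon>" "0 \<le> c * E k"
      using K k1 E assms(2) by auto
    then have 1: "dist (z k) zb < 2 * \<epsilon>"
      using step by (simp add: algebra_simps)
    \<comment> \<open>\<open>bound\<close> needs the next iterate in the ball too. This follows
      first from the smallness of single steps; only then is the sharper telescoping estimate
      available.\<close>
    have 2: "dist (z (Suc k)) zb \<le> dist (z (Suc k)) (z k) + dist (z k) zb"
      by (rule dist_triangle)
    moreover have "dist (z (Suc k)) (z k) < \<epsilon>"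
      using k1 K step by auto
    ultimately have "dist (z (Suc k)) (z k) \<le> c * (E k - E (Suc k))"
      using 1 \<epsilon> by (intro bound) auto
    then show ?case using 2 step by (simp add: algebra_simps)
  qed
  have "dist (z k) zb < e" if "k \<ge> K" for k
  proof -
    have "c * E K < \<epsilon>" "0 \<le> c * E k"
      using K k1 E assms(2) by auto
    then show ?thesis using main[OF that] \<epsilon> by (simp add: algebra_simps)
  qed
  then show "\<exists>no. \<forall>n\<ge>no. dist (z n) zb < e" by blast
qed

text \<open>The weighted inequality between geometric and arithmetic mean; a small
  \<open>\<kappa>\<close> lets the share of \<open>y\<close> be absorbed later.\<close>

lemma sqrt_mult_le_weighted_sum:
  fixes x y \<kappa> :: real
  assumes "0 \<le> x" "0 \<le> y" "0 < \<kappa>"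
  shows "sqrt (x * y) \<le> x / (4 * \<kappa>) + \<kappa> * y"
proof (rule real_le_lsqrt)
  have "(x / (4 * \<kappa>) + \<kappa> * y)\<^sup>2 - x * y = (x / (4 * \<kappa>) - \<kappa> * y)\<^sup>2"
    using assms by (simp add: power2_eq_square field_simps)
  then show "x * y \<le> (x / (4 * \<kappa>) + \<kappa> * y)\<^sup>2"
    by (metis diff_ge_0_iff_ge zero_le_power2)
qed (use assms in auto)

lemma sqrt_add3_le:
  fixes x y z :: real
  assumes "0 \<le> x" "0 \<le> y" "0 \<le> z"
  shows "sqrt (x + y + z) \<le> sqrt x + sqrt y + sqrt z"
  using assms sqrt_add_le_add_sqrt[of "x + y" z] sqrt_add_le_add_sqrt[of x y] by simp

text \<open>Separates the convergence argument from the algorithm. The objective may vary with the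
  index because one desingularizing function serves all of them, and the gaps \<open>r\<close> make
  their values comparable. Subgradients are bounded only inside the ball, hence the trapping
  argument at the end.\<close>

lemma KL_descent_convergence:
  fixes \<Phi> :: "nat \<Rightarrow> 'a::real_inner \<Rightarrow> real"
    and r A e :: "nat \<Rightarrow> real" and z :: "nat \<Rightarrow> 'a" and zb :: 'a
  defines "r \<equiv> \<lambda>k. \<Phi> k (z k) - \<Phi> k zb"
  assumes a: "0 \<le> a" "a < 1" and C: "0 \<le> C" and c: "0 \<le> c"
    and KL: "\<And>k. KL_property (\<Phi> k) zb \<rho> \<eta> \<theta> \<mu>"
    and r: "\<And>k. 0 < r k" "\<And>k. r (Suc k) \<le> r k" "\<And>k. ereal (r k) < \<eta>" "r \<longlonglongrightarrow> 0"
    and A: "\<And>k. 0 \<le> A k"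
    and e: "\<And>k. 0 \<le> e k" "summable e" "summable (\<lambda>k. sqrt (e k))"
    and descent: "\<And>k. A (Suc k) \<le> a\<^sup>2 * A k + e k + (r (Suc k) - r (Suc (Suc k)))"
    and steps: "\<And>k. dist (z (Suc k)) (z k) \<le> c * sqrt (A k)"
    and subgrad: "\<And>k. \<lbrakk>dist (z (Suc k)) zb \<le> \<rho>; dist (z (Suc (Suc k))) zb \<le> \<rho>\<rbrakk> \<Longrightarrow>
        \<exists>w \<in> limiting_subdiff (\<Phi> (Suc (Suc k))) (z (Suc (Suc k))).
          norm w \<le> C * (sqrt (A (Suc k)) + sqrt (A k))"
    and lim: "\<And>\<epsilon> n. 0 < \<epsilon> \<Longrightarrow> \<exists>k\<ge>n. dist (z k) zb < \<epsilon>"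
  shows "A \<longlonglongrightarrow> 0" "z \<longlonglongrightarrow> zb"
proof -
  have pars: "0 < \<rho>" "0 \<le> \<theta>" "\<theta> < 1" "0 < \<mu>"
    using KL[of 0] by (auto simp: KL_property_def)
  have r1: "(\<lambda>k. r (Suc k)) \<longlonglongrightarrow> 0"
    using r(4) by (rule LIMSEQ_Suc)
  \<comment> \<open>The gap differences telescope, so together with \<open>e\<close> they form a
    summable error of a contraction with factor \<open>a\<^sup>2\<close>.\<close>
  have "summable (\<lambda>k. e k + (r (Suc k) - r (Suc (Suc k))))"
    using e(2) telescope_summable'[OF r1] by (rule summable_add)
  moreover have "a\<^sup>2 < 1"
    using a by (simp add: abs_square_less_1)
  ultimately show A0: "A \<longlonglongrightarrow> 0"
    using contraction_with_summable_error_tendsto_0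
        [of A "a\<^sup>2" "\<lambda>k. e k + (r (Suc k) - r (Suc (Suc k)))"] A e(1) r(2) descent
    by (simp add: add_ac)
  define D where "D k = sqrt (A k)" for k
  have D: "0 \<le> D k" "A k = (D k)\<^sup>2" for k
    using A by (auto simp: D_def)
  have D0: "D \<longlonglongrightarrow> 0"
    using tendsto_real_sqrt[OF A0] by (simp add: D_def[abs_def])
  \<comment> \<open>The term \<open>\<kappa> * D k\<close> is moved into the potential, which costs
    \<open>\<kappa>\<close> a second time at \<open>D (Suc k)\<close>. This choice leaves
    \<open>1 - a - 2 * \<kappa> = (1 - a) / 2\<close>.\<close>
  define \<kappa> where "\<kappa> = (1 - a) / 4"
  have \<kappa>: "0 < \<kappa>" "1 - a - 2 * \<kappa> > 0"
    using a by (auto simp: \<kappa>_def)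
  \<comment> \<open>The desingularizing function at the gap, scaled by the factor that the split of
    the square root with weight \<open>\<kappa>\<close> produces.\<close>
  define x where "x k = C * \<mu> / (4 * \<kappa>) * r k powr (1 - \<theta>)" for k
  have x0: "x \<longlonglongrightarrow> 0"
  proof -
    have "(\<lambda>k. r k powr (1 - \<theta>)) \<longlonglongrightarrow> 0 powr (1 - \<theta>)"
      using r pars by (intro tendsto_powr' tendsto_const) (auto intro: less_imp_le always_eventually)
    then show ?thesis
      using tendsto_mult_left[of "\<lambda>k. r k powr (1 - \<theta>)" 0 sequentially "C * \<mu> / (4 * \<kappa>)"]
      by (simp add: x_def[abs_def])
  qed
  have x_nonneg: "0 \<le> x k" for k
    using C pars \<kappa> by (simp add: x_def)
  \<comment> \<open>The tail of the series of the roots of the errors, so that its decrease pays for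
    \<open>sqrt (e k)\<close>.\<close>
  define S where "S k = (\<Sum>k. sqrt (e k)) - (\<Sum>j<k. sqrt (e j))" for k
  have S_nonneg: "0 \<le> S k" for k
    unfolding S_def using sum_le_suminf[OF e(3), of "{..<k}"] e(1) by simp
  have S0: "S \<longlonglongrightarrow> 0"
    using tendsto_diff[OF tendsto_const[of "\<Sum>k. sqrt (e k)"] summable_LIMSEQ[OF e(3)]]
    by (simp add: S_def[abs_def])
  have S_Suc: "S (Suc k) = S k - sqrt (e k)" for k
    by (simp add: S_def)
  define E where "E k = D (Suc k) + \<kappa> * D k + x (Suc (Suc k)) + S (Suc k)" for k
  have "(\<lambda>k. D (Suc k) + \<kappa> * D k + x (Suc (Suc k)) + S (Suc k)) \<longlonglongrightarrow> 0 + \<kappa> * 0 + 0 + 0"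
    by (intro tendsto_add tendsto_mult_left LIMSEQ_Suc D0 x0 S0)
  then have E0: "E \<longlonglongrightarrow> 0"
    by (simp add: E_def[abs_def])
  have E_nonneg: "0 \<le> E k" for k
    using D x_nonneg S_nonneg \<kappa> by (simp add: E_def)
  have key: "(1 - a - 2 * \<kappa>) * D (Suc k) \<le> E k - E (Suc k)"
    if ball: "dist (z (Suc k)) zb \<le> \<rho>" "dist (z (Suc (Suc k))) zb \<le> \<rho>" for k
  proof -
    define r2 r3 where "r2 = r (Suc (Suc k))" and "r3 = r (Suc (Suc (Suc k)))"
    have rr: "0 < r3" "r3 \<le> r2" "ereal r2 < \<eta>" "0 < r2"
      using r by (auto simp: r2_def r3_def)
    obtain w where w: "w \<in> limiting_subdiff (\<Phi> (Suc (Suc k))) (z (Suc (Suc k)))"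
        "norm w \<le> C * (D (Suc k) + D k)"
      using subgrad[OF ball] by (auto simp: D_def)
    have r2_eq: "r2 = \<Phi> (Suc (Suc k)) (z (Suc (Suc k))) - \<Phi> (Suc (Suc k)) zb"
      by (simp add: r2_def r_def)
    have "r2 - r3 \<le> \<mu> * (r2 powr (1 - \<theta>) - r3 powr (1 - \<theta>)) * norm w"
      unfolding r2_eq using ball(2) rr w(1)
      by (intro KL_decrease[OF KL]) (auto simp: dist_norm r2_eq)
    also have "\<dots> \<le> \<mu> * (r2 powr (1 - \<theta>) - r3 powr (1 - \<theta>)) * (C * (D (Suc k) + D k))"
      using w(2) rr pars by (intro mult_left_mono mult_nonneg_nonneg) (auto intro: powr_mono2)
    finally have R: "r2 - r3
        \<le> (C * \<mu> * (r2 powr (1 - \<theta>) - r3 powr (1 - \<theta>))) * (D (Suc k) + D k)"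
      by (simp add: mult_ac)
    \<comment> \<open>The decrease of the gap is at most a product of a telescoping factor and two
      step lengths; its root is split into a decrease of \<open>x\<close> and a small multiple of
      the step lengths.\<close>
    have "sqrt (r2 - r3) \<le> (C * \<mu> * (r2 powr (1 - \<theta>) - r3 powr (1 - \<theta>))) / (4 * \<kappa>)
        + \<kappa> * (D (Suc k) + D k)"
      using rr pars C \<kappa> D
      by (intro order_trans[OF real_sqrt_le_mono[OF R]] sqrt_mult_le_weighted_sum)
        (auto intro!: mult_nonneg_nonneg powr_mono2)
    also have "\<dots> = x (Suc (Suc k)) - x (Suc (Suc (Suc k))) + \<kappa> * (D (Suc k) + D k)"
      by (simp add: x_def r2_def r3_def right_diff_distrib diff_divide_distrib)
    finally have 1: "sqrt (r2 - r3) \<le> \<dots>" .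
    \<comment> \<open>Taking roots term by term turns the contraction factor
      \<open>a\<^sup>2\<close> of squared lengths into the factor \<open>a\<close> of
      lengths.\<close>
    have "D (Suc (Suc k)) \<le> sqrt (a\<^sup>2 * A (Suc k) + e (Suc k) + (r2 - r3))"
      unfolding D_def r2_def r3_def using descent by (rule real_sqrt_le_mono)
    also have "\<dots> \<le> sqrt (a\<^sup>2 * A (Suc k)) + sqrt (e (Suc k)) + sqrt (r2 - r3)"
      using A e(1) rr by (intro sqrt_add3_le) auto
    also have "sqrt (a\<^sup>2 * A (Suc k)) = a * D (Suc k)"
      using a by (simp add: real_sqrt_mult D_def)
    finally show ?thesis
      using 1 by (simp add: E_def S_Suc[of "Suc k"] algebra_simps)
  qed
  \<comment> \<open>\<open>key\<close> needs the iterates \<open>Suc k\<close> and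
    \<open>Suc (Suc k)\<close> in the ball, so the trapping argument runs on the shifted
    sequence.\<close>
  have "(\<lambda>k. z (Suc k)) \<longlonglongrightarrow> zb"
  proof (rule convergent_to_limit_point_by_potential)
    show "0 < \<rho>" "0 \<le> c / (1 - a - 2 * \<kappa>)"
      using pars c \<kappa> by auto
    show "0 \<le> E k" for k by (rule E_nonneg)
    show "E \<longlonglongrightarrow> 0" by (rule E0)
    have "(\<lambda>k. c * D (Suc k)) \<longlonglongrightarrow> 0"
      using tendsto_mult_left[OF LIMSEQ_Suc[OF D0], of c] by simp
    then show "(\<lambda>k. dist (z (Suc (Suc k))) (z (Suc k))) \<longlonglongrightarrow> 0"
      by (rule tendsto_sandwich[OF _ _ tendsto_const, rotated 2])
        (use steps in \<open>auto simp: D_def\<close>)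
    show "dist (z (Suc (Suc k))) (z (Suc k)) \<le> c / (1 - a - 2 * \<kappa>) * (E k - E (Suc k))"
      if "dist (z (Suc k)) zb \<le> \<rho>" "dist (z (Suc (Suc k))) zb \<le> \<rho>" for k
    proof -
      have "D (Suc k) \<le> (E k - E (Suc k)) / (1 - a - 2 * \<kappa>)"
        using key[OF that] \<kappa> by (simp add: pos_le_divide_eq mult.commute)
      then have "c * D (Suc k) \<le> c * ((E k - E (Suc k)) / (1 - a - 2 * \<kappa>))"
        using c by (rule mult_left_mono)
      then show ?thesis using steps[of "Suc k"] by (simp add: D_def)
    qed
    show "\<exists>k\<ge>n. dist (z (Suc k)) zb < \<epsilon>" if "0 < \<epsilon>" for \<epsilon> n
      using lim[OF that, of "Suc n"] by (metis Suc_le_D Suc_le_mono)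
  qed
  then show "z \<longlonglongrightarrow> zb" by (rule LIMSEQ_imp_Suc)
qed

section \<open>The column penalty\<close>

definition pen :: "('d::finite \<Rightarrow> real) \<Rightarrow> real \<Rightarrow> real ^ 'd ^ 'm \<Rightarrow> real" where
  "pen w q X = (\<Sum>t\<in>UNIV. w t / q * norm (column t X) powr q)"

definition pen_grad :: "('d::finite \<Rightarrow> real) \<Rightarrow> real \<Rightarrow> real ^ 'd ^ 'm \<Rightarrow> real ^ 'd ^ 'm" where
  "pen_grad w q X = (\<chi> i t. w t * norm (column t X) powr (q - 2) * X $ i $ t)"

lemma inner_matrix_columns: "A \<bullet> B = (\<Sum>t\<in>UNIV. column t A \<bullet> column t B)"
  for A B :: "real ^ 'd ^ 'm"
  unfolding inner_vec_def column_def by (simp, rule sum.swap)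

lemma norm_matrix_columns: "(norm A)\<^sup>2 = (\<Sum>t\<in>UNIV. (norm (column t A))\<^sup>2)"
  for A :: "real ^ 'd ^ 'm"
  by (simp only: power2_norm_eq_inner inner_matrix_columns)

lemma column_linear [simp]:
  fixes A B :: "real ^ 'd ^ 'm"
  shows "column t (A + B) = column t A + column t B"
    "column t (A - B) = column t A - column t B"
    "column t (- A) = - column t A"
    "column t (c *\<^sub>R A) = c *\<^sub>R column t A"
  by (simp_all add: column_def vec_eq_iff)

lemma matrix_eq_columns:
  fixes A B :: "'a ^ 'd ^ 'm"
  assumes "\<And>t. column t A = column t B"
  shows "A = B"
  using assms by (simp add: column_def vec_eq_iff)

lemma bounded_linear_column: "bounded_linear (column t :: real ^ 'd ^ 'm \<Rightarrow> real ^ 'm)"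
  by (simp add: linear_conv_bounded_linear[symmetric] linear_iff)

lemma column_pen_grad:
  "column t (pen_grad w q X) = (w t * norm (column t X) powr (q - 2)) *\<^sub>R column t X"
  by (simp add: pen_grad_def column_def vec_eq_iff)

lemma GDERIV_norm_powr:
  fixes x :: "'a::real_inner"
  assumes "x \<noteq> 0"
  shows "GDERIV (\<lambda>x. norm x powr q) x :> (q * norm x powr (q - 2)) *\<^sub>R x"
proof -
  have "GDERIV (\<lambda>x. norm x powr q) x :> (q * norm x powr (q - 1)) *\<^sub>R sgn x"
    using assms by (intro GDERIV_DERIV_compose[OF GDERIV_norm] has_real_derivative_powr) auto
  moreover have "norm x powr (q - 1) / norm x = norm x powr (q - 2)"
    using assms powr_diff[of "norm x" "q - 1" 1] by simp
  then have "(q * norm x powr (q - 1)) *\<^sub>R sgn x = (q * norm x powr (q - 2)) *\<^sub>R x"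
    by (simp add: sgn_div_norm divide_inverse mult.assoc)
  ultimately show ?thesis by simp
qed

lemma GDERIV_pen:
  fixes X :: "real ^ 'd ^ 'm"
  assumes "q \<noteq> 0" "\<And>t. column t X \<noteq> 0"
  shows "GDERIV (pen w q) X :> pen_grad w q X"
proof -
  have "((\<lambda>X. norm (column t X) powr q) has_derivative
      (\<lambda>H. column t H \<bullet> ((q * norm (column t X) powr (q - 2)) *\<^sub>R column t X))) (at X)" for t
    using bounded_linear.has_derivative[OF bounded_linear_column has_derivative_ident]
      GDERIV_norm_powr[OF assms(2), unfolded gderiv_def]
    by (rule has_derivative_compose)
  then have "((\<lambda>X. \<Sum>t\<in>UNIV. w t / q * norm (column t X) powr q) has_derivative
      (\<lambda>H. \<Sum>t\<in>UNIV. w t / q *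
        (column t H \<bullet> ((q * norm (column t X) powr (q - 2)) *\<^sub>R column t X)))) (at X)"
    by (intro has_derivative_sum has_derivative_mult_right)
  moreover have "(\<Sum>t\<in>UNIV. w t / q *
        (column t H \<bullet> ((q * norm (column t X) powr (q - 2)) *\<^sub>R column t X)))
      = H \<bullet> pen_grad w q X" for H
    using assms(1) by (simp add: inner_matrix_columns column_pen_grad mult_ac)
  ultimately show ?thesis
    by (simp add: gderiv_def pen_def[abs_def])
qed

lemma pen_nonneg: "0 < q \<Longrightarrow> (\<And>t. 0 \<le> w t) \<Longrightarrow> 0 \<le> pen w q X"
  by (simp add: pen_def sum_nonneg)

lemma pen_diff_le:
  assumes "0 < q" "\<And>t. \<bar>w t - w' t\<bar> \<le> e * w t"
  shows "\<bar>pen w q X - pen w' q X\<bar> \<le> e * pen w q X"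
proof -
  have "\<bar>pen w q X - pen w' q X\<bar> = \<bar>\<Sum>t\<in>UNIV. (w t - w' t) / q * norm (column t X) powr q\<bar>"
    by (simp add: pen_def sum_subtractf[symmetric] diff_divide_distrib left_diff_distrib)
  also have "\<dots> \<le> (\<Sum>t\<in>UNIV. \<bar>w t - w' t\<bar> / q * norm (column t X) powr q)"
    using assms(1) by (intro order_trans[OF sum_abs]) (simp add: abs_mult)
  also have "\<dots> \<le> (\<Sum>t\<in>UNIV. (e * w t) / q * norm (column t X) powr q)"
    using assms by (intro sum_mono mult_right_mono divide_right_mono) auto
  also have "\<dots> = e * pen w q X"
    by (simp add: pen_def sum_distrib_left mult_ac)
  finally show ?thesis .
qed

text \<open>Each column of the gradient is linear in its weight, so a relative error of the weights
  carries over. The relative form remains useful when a column tends to 0 with an exponent below 1,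
  where no a priori bound on the gradient exists.\<close>

lemma norm_pen_grad_diff_le:
  assumes "0 \<le> e" "\<And>t. \<bar>w t - w' t\<bar> \<le> e * w t"
  shows "norm (pen_grad w q X - pen_grad w' q X) \<le> e * norm (pen_grad w q X)"
proof -
  have "norm (column t (pen_grad w q X - pen_grad w' q X)) \<le> e * norm (column t (pen_grad w q X))"
    for t
  proof -
    have "column t (pen_grad w q X - pen_grad w' q X)
        = ((w t - w' t) * norm (column t X) powr (q - 2)) *\<^sub>R column t X"
      by (simp add: column_pen_grad left_diff_distrib scaleR_diff_left)
    then have "norm (column t (pen_grad w q X - pen_grad w' q X))
        = \<bar>w t - w' t\<bar> * (norm (column t X) powr (q - 2) * norm (column t X))"
      by (simp add: abs_mult)
    also have "\<dots> \<le> (e * \<bar>w t\<bar>) * (norm (column t X) powr (q - 2) * norm (column t X))"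
      using assms(2)[of t] assms(1)
      by (intro mult_right_mono order_trans[OF assms(2)] mult_left_mono) auto
    finally show ?thesis by (simp add: column_pen_grad abs_mult mult_ac)
  qed
  then have "(norm (pen_grad w q X - pen_grad w' q X))\<^sup>2
      \<le> (\<Sum>t\<in>UNIV. (e * norm (column t (pen_grad w q X)))\<^sup>2)"
    unfolding norm_matrix_columns by (intro sum_mono power_mono) auto
  also have "\<dots> = (e * norm (pen_grad w q X))\<^sup>2"
    by (simp only: power_mult_distrib norm_matrix_columns sum_distrib_left)
  finally show ?thesis
    by (rule power2_le_imp_le) (use assms(1) in simp)
qed

section \<open>One block of the iteration\<close>

text \<open>Away from 0 the norm power is differentiable, so Fermat's rule applies to the prox
  objective; the result is scaled by \<open>c\<close>.\<close>

lemma prox_norm_powr_stationary: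
  fixes x z :: "'a::real_inner"
  assumes z: "z \<in> prox (\<lambda>x. w / (q * c) * norm x powr q) x" "z \<noteq> 0" and "q \<noteq> 0" "c \<noteq> 0"
  shows "(w * norm z powr (q - 2)) *\<^sub>R z = c *\<^sub>R (x - z)"
proof -
  define h where "h y = 1 / 2 * (norm (y - x))\<^sup>2 + w / (q * c) * norm y powr q" for y
  define D where "D = (z - x) + (w / (q * c)) *\<^sub>R (q * norm z powr (q - 2)) *\<^sub>R z"
  have 1: "((\<lambda>y. 1 / 2 * (norm (y - x))\<^sup>2) has_derivative (\<lambda>k. k \<bullet> (z - x))) (at z)"
    unfolding power2_norm_eq_inner
    by (auto intro!: derivative_eq_intros simp: inner_commute)
  have 2: "((\<lambda>y. w / (q * c) * norm y powr q) has_derivative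
      (\<lambda>k. w / (q * c) * (k \<bullet> ((q * norm z powr (q - 2)) *\<^sub>R z)))) (at z)"
    by (intro has_derivative_mult_right GDERIV_norm_powr[OF z(2), unfolded gderiv_def])
  have "(h has_derivative (\<lambda>k. k \<bullet> D)) (at z)"
    using has_derivative_add[OF 1 2] assms(3)
    by (simp add: h_def[abs_def] D_def inner_add_right mult_ac)
  moreover have "h z \<le> h y" for y
    using z(1) unfolding prox_def is_arg_min_def h_def by (auto simp: not_less)
  ultimately have "(\<lambda>k. k \<bullet> D) = (\<lambda>k. 0)"
    by (intro has_derivative_local_min[of h _ z]) auto
  then have "D \<bullet> D = 0" by (rule fun_cong)
  then have "c *\<^sub>R D = 0" by simp
  then show ?thesis
    using assms(3,4) by (simp add: D_def algebra_simps)
qed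

text \<open>Serves both half-steps: \<open>f\<close> is the smooth part with the other factor
  frozen, \<open>X0\<close> and \<open>X1\<close> are the last two iterates, \<open>Y\<close> is the
  extrapolated point and \<open>X2\<close> the new block.\<close>

locale block_step =
  fixes f :: "real ^ 'd ^ 'm \<Rightarrow> real" and G :: "real ^ 'd ^ 'm \<Rightarrow> real ^ 'd ^ 'm"
    and c q b :: real and w :: "'d \<Rightarrow> real" and X0 X1 X2 Y :: "real ^ 'd ^ 'm"
  assumes GDERIV_f: "\<And>X. GDERIV f X :> G X"
    and lipschitz_G: "(c / 2)-lipschitz_on UNIV G"
    and c_pos: "0 < c" and q_pos: "0 < q" and b_nonneg: "0 \<le> b"
    and Y_eq: "Y = X1 + b *\<^sub>R (X1 - X0)"
    and X2_prox: "\<And>t. column t X2 \<in>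
      prox (\<lambda>x. w t / (q * c) * norm x powr q) (column t (Y - (1 / c) *\<^sub>R G Y))"
begin

text \<open>The minimizer \<open>X2\<close> is compared with the previous iterate \<open>X1\<close>
  in every column of the prox problem. After scaling by \<open>c\<close> the columns add up to an
  inequality between matrices.\<close>

lemma pen_decrease:
  "pen w q X2 \<le> pen w q X1 - c / 2 * (norm (X2 - X1))\<^sup>2 - (X2 - X1) \<bullet> G Y
     + c * b * ((X2 - X1) \<bullet> (X1 - X0))"
proof -
  define Z where "Z = Y - (1 / c) *\<^sub>R G Y"
  have "c * (1 / 2 * (norm (column t X2 - column t Z))\<^sup>2 + w t / (q * c) * norm (column t X2) powr q)
      \<le> c * (1 / 2 * (norm (column t X1 - column t Z))\<^sup>2 + w t / (q * c) * norm (column t X1) powr q)"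
    for t
    using X2_prox[of t] c_pos unfolding prox_def is_arg_min_def Z_def[symmetric]
    by (intro mult_left_mono) (auto simp: not_less)
  then have "(\<Sum>t\<in>UNIV. c / 2 * (norm (column t (X2 - Z)))\<^sup>2 + w t / q * norm (column t X2) powr q)
      \<le> (\<Sum>t\<in>UNIV. c / 2 * (norm (column t (X1 - Z)))\<^sup>2 + w t / q * norm (column t X1) powr q)"
    using c_pos by (intro sum_mono) (simp add: distrib_left)
  then have "c / 2 * (norm (X2 - Z))\<^sup>2 + pen w q X2 \<le> c / 2 * (norm (X1 - Z))\<^sup>2 + pen w q X1"
    unfolding norm_matrix_columns pen_def by (simp add: sum.distrib sum_distrib_left)
  \<comment> \<open>Expanding around \<open>X1\<close> replaces the gradient step point
    \<open>Z\<close> by the gradient at \<open>Y\<close> and the extrapolation direction.\<close>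
  moreover have "c / 2 * (norm (X2 - Z))\<^sup>2 - c / 2 * (norm (X1 - Z))\<^sup>2
      = c / 2 * (norm (X2 - X1))\<^sup>2 + (X2 - X1) \<bullet> G Y - c * b * ((X2 - X1) \<bullet> (X1 - X0))"
  proof -
    have "(norm (u + v))\<^sup>2 - (norm v)\<^sup>2 = (norm u)\<^sup>2 + 2 * (u \<bullet> v)" for u v :: "real ^ 'd ^ 'm"
      by (simp add: power2_norm_eq_inner inner_add_left inner_add_right inner_commute[of v u])
    from this[of "X2 - X1" "X1 - Z"] have "(norm (X2 - Z))\<^sup>2 - (norm (X1 - Z))\<^sup>2
        = (norm (X2 - X1))\<^sup>2 + 2 * ((X2 - X1) \<bullet> (X1 - Z))"
      by simp
    moreover have "X1 - Z = (1 / c) *\<^sub>R G Y - b *\<^sub>R (X1 - X0)"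
      by (simp add: Z_def Y_eq)
    then have "(X2 - X1) \<bullet> (X1 - Z) = (X2 - X1) \<bullet> G Y / c - b * ((X2 - X1) \<bullet> (X1 - X0))"
      by (simp only: inner_diff_right[of "X2 - X1"] inner_scaleR_right) simp
    ultimately show ?thesis
      using c_pos by (simp add: field_simps)
  qed
  ultimately show ?thesis by simp
qed

text \<open>Of the gain \<open>c / 2\<close> in \<open>pen_decrease\<close> the descent lemma with
  constant \<open>c / 2\<close> consumes \<open>c / 4\<close>, and absorbing the extrapolation terms
  consumes another \<open>c / 8\<close>.\<close>

lemma descent:
  "f X2 + pen w q X2 + c / 8 * (norm (X2 - X1))\<^sup>2
     \<le> f X1 + pen w q X1 + 9 / 2 * c * b\<^sup>2 * (norm (X1 - X0))\<^sup>2"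
proof -
  define \<Delta> e where "\<Delta> = norm (X2 - X1)" and "e = b * norm (X1 - X0)"
  have "f X2 \<le> f X1 + G X1 \<bullet> (X2 - X1) + c / 2 / 2 * (norm (X2 - X1))\<^sup>2"
    by (rule lipschitz_gradient_upper_bound[OF GDERIV_f lipschitz_G])
  \<comment> \<open>The subproblem uses the gradient at \<open>Y\<close>, the descent lemma the one
    at \<open>X1\<close>.\<close>
  moreover have "(G X1 - G Y) \<bullet> (X2 - X1) \<le> c / 2 * e * \<Delta>"
  proof -
    have "(G X1 - G Y) \<bullet> (X2 - X1) \<le> norm (G X1 - G Y) * \<Delta>"
      unfolding \<Delta>_def by (rule norm_cauchy_schwarz)
    also have "norm (G X1 - G Y) \<le> c / 2 * dist X1 Y"
      using lipschitz_onD[OF lipschitz_G, of X1 Y] by (simp add: dist_norm)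
    also have "dist X1 Y = e"
      using b_nonneg by (simp add: Y_eq e_def dist_norm)
    finally show ?thesis by (simp add: \<Delta>_def mult_right_mono)
  qed
  moreover have "c * b * ((X2 - X1) \<bullet> (X1 - X0)) \<le> c * e * \<Delta>"
  proof -
    have "c * b * ((X2 - X1) \<bullet> (X1 - X0)) \<le> c * b * (\<Delta> * norm (X1 - X0))"
      unfolding \<Delta>_def using c_pos b_nonneg by (intro mult_left_mono norm_cauchy_schwarz) auto
    then show ?thesis by (simp add: e_def mult_ac)
  qed
  \<comment> \<open>The two extrapolation terms add up to \<open>3 / 2 * (c * e * \<Delta>)\<close>;
    the square with coefficient 6 is the one that leaves exactly \<open>c / 8\<close> for
    \<open>\<Delta>\<^sup>2\<close>.\<close>
  moreover have "3 / 2 * (c * e * \<Delta>) \<le> c / 8 * \<Delta>\<^sup>2 + 9 / 2 * c * e\<^sup>2"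
  proof -
    have "0 \<le> c / 8 * (\<Delta> - 6 * e)\<^sup>2" using c_pos by simp
    then show ?thesis by (simp add: power2_eq_square algebra_simps)
  qed
  moreover have "(G X1 - G Y) \<bullet> (X2 - X1) = G X1 \<bullet> (X2 - X1) - (X2 - X1) \<bullet> G Y"
    by (simp add: inner_diff_left inner_commute[of _ "G Y"])
  moreover have "c / 2 * e * \<Delta> = 1 / 2 * (c * e * \<Delta>)" by simp
  moreover have "9 / 2 * c * e\<^sup>2 = 9 / 2 * c * b\<^sup>2 * (norm (X1 - X0))\<^sup>2"
    by (simp add: e_def power_mult_distrib)
  ultimately show ?thesis
    using pen_decrease unfolding \<Delta>_def by linarith
qed

lemma stationary:
  assumes "\<And>t. column t X2 \<noteq> 0"
  shows "pen_grad w q X2 = c *\<^sub>R (Y - X2) - G Y"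
proof (rule matrix_eq_columns)
  fix t
  have "(w t * norm (column t X2) powr (q - 2)) *\<^sub>R column t X2
      = c *\<^sub>R (column t (Y - (1 / c) *\<^sub>R G Y) - column t X2)"
    using assms q_pos c_pos by (intro prox_norm_powr_stationary[OF X2_prox]) auto
  then show "column t (pen_grad w q X2) = column t (c *\<^sub>R (Y - X2) - G Y)"
    using c_pos by (simp add: column_pen_grad algebra_simps)
qed

lemma norm_Y_diff_le: "norm (Y - X2) \<le> norm (X2 - X1) + b * norm (X1 - X0)"
proof -
  have "Y - X2 = (X1 - X2) + b *\<^sub>R (X1 - X0)" by (simp add: Y_eq)
  then have "norm (Y - X2) \<le> norm (X1 - X2) + norm (b *\<^sub>R (X1 - X0))"
    by (simp only: norm_triangle_ineq)
  then show ?thesis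
    using b_nonneg by (simp add: norm_minus_commute[of X1 X2])
qed

end

section \<open>The objective\<close>

lemma bounded_bilinear_matrix_mult_transpose:
  "bounded_bilinear (\<lambda>(U :: real ^ 'd ^ 'm) (V :: real ^ 'd ^ 'n). U ** transpose V)"
  unfolding bilinear_conv_bounded_bilinear[symmetric] bilinear_def
  by (auto simp: linear_iff matrix_matrix_mult_def transpose_def vec_eq_iff distrib_left
      distrib_right sum.distrib sum_distrib_left mult_ac)

context
  fixes F :: "real ^ 'n ^ 'm \<Rightarrow> real"
  assumes F: "continuously_differentiable F"
begin

lemma differentiable_comp_continuously_differentiable:
  assumes "g differentiable at x"
  shows "(\<lambda>x. F (g x)) differentiable at x"
proof -
  have "F differentiable at (g x)"
    using F by (auto simp: continuously_differentiable_def gderiv_def differentiable_def)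
  then show ?thesis
    using differentiable_chain_at[OF assms] by (simp add: o_def)
qed

lemma GDERIV_grad_U: "GDERIV (\<lambda>X. F (X ** transpose V)) U :> grad_U F U V"
  unfolding grad_U_def
  by (intro differentiable_imp_GDERIV differentiable_comp_continuously_differentiable
      bounded_linear_imp_differentiable
      bounded_bilinear.bounded_linear_left[OF bounded_bilinear_matrix_mult_transpose])

lemma GDERIV_grad_V: "GDERIV (\<lambda>Y. F (U ** transpose Y)) V :> grad_V F U V"
  unfolding grad_V_def
  by (intro differentiable_imp_GDERIV differentiable_comp_continuously_differentiable
      bounded_linear_imp_differentiable
      bounded_bilinear.bounded_linear_right[OF bounded_bilinear_matrix_mult_transpose])

text \<open>The joint map is differentiable as \<open>F\<close> after a bilinear map. Composing with
  the embeddings of the two factors identifies the components of its gradient with the partial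
  gradients.\<close>

lemma GDERIV_joint:
  fixes U :: "real ^ 'd ^ 'm" and V :: "real ^ 'd ^ 'n"
  shows "GDERIV (\<lambda>(U, V). F (U ** transpose V)) (U, V) :> (grad_U F U V, grad_V F U V)"
proof -
  define f where "f z = F (fst z ** transpose (snd z))" for z :: "(real ^ 'd ^ 'm) \<times> (real ^ 'd ^ 'n)"
  have "(\<lambda>z :: (real ^ 'd ^ 'm) \<times> (real ^ 'd ^ 'n). fst z ** transpose (snd z))
      differentiable at (U, V)"
    using bounded_bilinear.FDERIV[OF bounded_bilinear_matrix_mult_transpose
        has_derivative_fst[OF has_derivative_ident] has_derivative_snd[OF has_derivative_ident]]
    unfolding differentiable_def by blast
  then have D: "GDERIV f (U, V) :> gradient f (U, V)"
    unfolding f_def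
    by (intro differentiable_imp_GDERIV differentiable_comp_continuously_differentiable)
  obtain D1 D2 where D12: "gradient f (U, V) = (D1, D2)" by fastforce
  have "((\<lambda>X. f (X, V)) has_derivative (\<lambda>h. (h, 0) \<bullet> (D1, D2))) (at U)"
    using D unfolding D12 gderiv_def
    by (rule has_derivative_compose[of "\<lambda>X. (X, V)" "\<lambda>h. (h, 0)" U UNIV f, rotated])
      (auto intro!: derivative_eq_intros)
  then have "GDERIV (\<lambda>X. F (X ** transpose V)) U :> D1"
    by (simp add: gderiv_def f_def)
  moreover have "((\<lambda>Y. f (U, Y)) has_derivative (\<lambda>h. (0, h) \<bullet> (D1, D2))) (at V)"
    using D unfolding D12 gderiv_def
    by (rule has_derivative_compose[of "\<lambda>Y. (U, Y)" "\<lambda>h. (0, h)" V UNIV f, rotated])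
      (auto intro!: derivative_eq_intros)
  then have "GDERIV (\<lambda>Y. F (U ** transpose Y)) V :> D2"
    by (simp add: gderiv_def f_def)
  ultimately have "D1 = grad_U F U V" "D2 = grad_V F U V"
    unfolding grad_U_def grad_V_def by (simp_all add: GDERIV_imp_gradient)
  then show ?thesis
    using D[unfolded D12] by (simp add: f_def[abs_def] case_prod_unfold)
qed

lemma GDERIV_Phi_weighted:
  fixes U :: "real ^ 'd ^ 'm" and V :: "real ^ 'd ^ 'n"
  assumes "q \<noteq> 0" "p \<noteq> 0" "\<And>t. column t U \<noteq> 0" "\<And>t. column t V \<noteq> 0"
  shows "GDERIV (Phi_weighted F q p w1 w2) (U, V) :>
    (grad_U F U V + pen_grad w1 q U, grad_V F U V + pen_grad w2 p V)"
proof -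
  have 1: "((\<lambda>z. pen w1 q (fst z)) has_derivative (\<lambda>h. fst h \<bullet> pen_grad w1 q U)) (at (U, V))"
    using GDERIV_pen[OF assms(1,3)] unfolding gderiv_def
    by (intro has_derivative_compose[OF has_derivative_fst[OF has_derivative_ident]]) auto
  have 2: "((\<lambda>z. pen w2 p (snd z)) has_derivative (\<lambda>h. snd h \<bullet> pen_grad w2 p V)) (at (U, V))"
    using GDERIV_pen[OF assms(2,4)] unfolding gderiv_def
    by (intro has_derivative_compose[OF has_derivative_snd[OF has_derivative_ident]]) auto
  show ?thesis
    using has_derivative_add[OF has_derivative_add[OF GDERIV_joint[unfolded gderiv_def] 1] 2]
    by (simp add: gderiv_def Phi_weighted_def pen_def case_prod_unfold inner_prod_def
        inner_add_right add_ac)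
qed

end

section \<open>Column weights and continuity of the objective\<close>

lemma Phi_weighted_eq_pen:
  "Phi_weighted F q p w1 w2 (U, V) = F (U ** transpose V) + pen w1 q U + pen w2 p V"
  by (simp add: Phi_weighted_def pen_def)

lemma Phi_eq_Phi_weighted: "Phi F q p c = Phi_weighted F q p (\<lambda>_. c) (\<lambda>_. c)"
  by (simp add: Phi_def Phi_weighted_def norm_2q_powr_def sum_distrib_left)

text \<open>With \<open>y\<close> the root of \<open>w / l\<close> of order \<open>q + 1\<close>,
  closeness of \<open>1 / y\<close> to 1 confines \<open>y\<close> to a fixed interval around 1, on
  which powers with exponent at most 3 are controlled by the cube.\<close>

lemma weight_close:
  fixes w l q \<delta> :: real
  assumes "0 < l" "0 < w" "0 < q" "q \<le> 2" "\<delta> \<le> 1 / 4"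
    and close: "\<bar>(l / w) powr (1 / (q + 1)) - 1\<bar> \<le> \<delta>"
  shows "\<bar>w - l\<bar> \<le> 7 * \<delta> * l" "l / 2 \<le> w"
proof -
  define y where "y = 1 / (l / w) powr (1 / (q + 1))"
  have y_pos: "0 < y" using assms by (simp add: y_def)
  have y1: "\<bar>1 / y - 1\<bar> \<le> \<delta>" using close by (simp add: y_def)
  have y: "4 / 5 \<le> y" "y \<le> 4 / 3"
  proof -
    have "1 / y \<le> 5 / 4" "3 / 4 \<le> 1 / y"
      using y1 assms(5) by auto
    then show "4 / 5 \<le> y" "y \<le> 4 / 3"
      using y_pos by (auto simp: field_simps)
  qed
  have w_eq: "w = l * y powr (q + 1)"
    using assms by (simp add: y_def powr_divide powr_powr)
  have "\<bar>y - 1\<bar> = y * \<bar>1 / y - 1\<bar>"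
    using y_pos by (simp add: abs_if field_simps)
  also have "\<dots> \<le> 4 / 3 * \<delta>"
    using y y_pos y1 by (intro mult_mono) auto
  finally have dy: "\<bar>y - 1\<bar> \<le> 4 / 3 * \<delta>" .
  \<comment> \<open>The power lies between 1 and \<open>y ^ 3\<close>. For
    \<open>y \<le> 4 / 3\<close> the cofactor \<open>y * y + y + 1\<close> is at most 37/9, hence
    below 5, and \<open>5 * 4 / 3\<close> is below 7; the lower bound holds since the cube of 4/5
    exceeds 1/2.\<close>
  have "\<bar>y powr (q + 1) - 1\<bar> \<le> 5 * \<bar>y - 1\<bar> \<and> 1 / 2 \<le> y powr (q + 1)"
  proof (cases "1 \<le> y")
    case True
    have "1 \<le> y powr (q + 1)" using True assms by (simp add: ge_one_powr_ge_zero)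
    moreover have "y powr (q + 1) \<le> y powr 3" using True assms by (intro powr_mono) auto
    moreover have "y powr 3 = y ^ 3" using y_pos by simp
    moreover have "y ^ 3 - 1 = (y - 1) * (y * y + y + 1)" by (simp add: power3_eq_cube algebra_simps)
    moreover have "(y - 1) * (y * y + y + 1) \<le> (y - 1) * 5"
      using True y mult_mono[of y "4/3" y "4/3"] by (intro mult_left_mono) auto
    ultimately show ?thesis using True by auto
  next
    case False
    have "y powr (q + 1) \<le> 1" using False y_pos assms by (simp add: powr_le1)
    moreover have "y powr 3 \<le> y powr (q + 1)" using False y_pos assms by (intro powr_mono') auto
    moreover have "y powr 3 = y ^ 3" using y_pos by simp
    moreover have "1 - y ^ 3 = (1 - y) * (y * y + y + 1)" by (simp add: power3_eq_cube algebra_simps)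
    moreover have "(1 - y) * (y * y + y + 1) \<le> (1 - y) * 5"
      using False y_pos mult_mono[of y 1 y 1] by (intro mult_left_mono) auto
    moreover have "(4 / 5) ^ 3 \<le> y ^ 3" using y by (intro power_mono) auto
    then have "1 / 2 \<le> y ^ 3" by (simp add: power3_eq_cube)
    ultimately show ?thesis using False by auto
  qed
  then have 1: "\<bar>y powr (q + 1) - 1\<bar> \<le> 7 * \<delta>" "1 / 2 \<le> y powr (q + 1)"
    using dy by auto
  have "\<bar>w - l\<bar> = l * \<bar>y powr (q + 1) - 1\<bar>"
    using assms(1) by (simp add: w_eq abs_if algebra_simps)
  also have "\<dots> \<le> l * (7 * \<delta>)"
    using 1 assms(1) by (intro mult_left_mono) auto
  finally show "\<bar>w - l\<bar> \<le> 7 * \<delta> * l" by (simp add: mult_ac)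
  show "l / 2 \<le> w"
    using mult_left_mono[OF 1(2), of l] assms(1) by (simp add: w_eq)
qed

text \<open>Positivity of the exponents keeps the norm powers continuous at zero columns, which the
  limit may have.\<close>

lemma tendsto_Phi_weighted:
  fixes Us :: "nat \<Rightarrow> real ^ 'd ^ 'm" and Vs :: "nat \<Rightarrow> real ^ 'd ^ 'n"
  assumes F: "continuously_differentiable F" and qp: "0 < q" "0 < p"
    and z: "(\<lambda>j. (Us j, Vs j)) \<longlonglongrightarrow> (Ub, Vb)"
    and w: "\<And>t. (\<lambda>j. w1 j t) \<longlonglongrightarrow> c1 t" "\<And>t. (\<lambda>j. w2 j t) \<longlonglongrightarrow> c2 t"
  shows "(\<lambda>j. Phi_weighted F q p (w1 j) (w2 j) (Us j, Vs j)) \<longlonglongrightarrow> Phi_weighted F q p c1 c2 (Ub, Vb)"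
proof -
  have U: "Us \<longlonglongrightarrow> Ub" and V: "Vs \<longlonglongrightarrow> Vb"
    using tendsto_fst[OF z] tendsto_snd[OF z] by simp_all
  have "isCont F x" for x
    using F has_derivative_continuous
    unfolding continuously_differentiable_def gderiv_def by blast
  then have "(\<lambda>j. F (Us j ** transpose (Vs j))) \<longlonglongrightarrow> F (Ub ** transpose Vb)"
    by (rule isCont_tendsto_compose)
      (rule bounded_bilinear.tendsto[OF bounded_bilinear_matrix_mult_transpose U V])
  moreover have "(\<lambda>j. norm (column t (Us j)) powr q) \<longlonglongrightarrow> norm (column t Ub) powr q" for t
    using qp by (intro tendsto_powr' tendsto_const tendsto_norm
        bounded_linear.tendsto[OF bounded_linear_column U]) auto
  moreover have "(\<lambda>j. norm (column t (Vs j)) powr p) \<longlonglongrightarrow> norm (column t Vb) powr p" for t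
    using qp by (intro tendsto_powr' tendsto_const tendsto_norm
        bounded_linear.tendsto[OF bounded_linear_column V]) auto
  ultimately show ?thesis
    unfolding Phi_weighted_def using qp w
    by (auto intro!: tendsto_add tendsto_sum tendsto_mult tendsto_divide tendsto_const)
qed

lemma lipschitz_on_cball_tendsto:
  fixes g :: "'a::real_normed_vector \<Rightarrow> 'b::metric_space"
  assumes "C-lipschitz_on (cball x \<rho>) g" "0 < \<rho>" "z \<longlonglongrightarrow> x"
  shows "(\<lambda>k. g (z k)) \<longlonglongrightarrow> g x"
proof -
  have "continuous_on (cball x \<rho>) g"
    using assms(1) by (rule lipschitz_on_continuous_on)
  then have "isCont g x"
    by (rule continuous_on_interior) (use assms(2) in \<open>auto intro: interiorI[of "ball x \<rho>"]\<close>)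
  then show ?thesis using assms(3) by (rule isCont_tendsto_compose)
qed

text \<open>One small term of the subsequence suffices: monotonicity keeps all later terms below
  it.\<close>

lemma decseq_from_tendsto_0_subseq:
  fixes r :: "nat \<Rightarrow> real"
  assumes pos: "\<And>k. K \<le> k \<Longrightarrow> 0 \<le> r k" and dec: "\<And>k. K \<le> k \<Longrightarrow> r (Suc k) \<le> r k"
    and s: "strict_mono s" "(r \<circ> s) \<longlonglongrightarrow> 0"
  shows "r \<longlonglongrightarrow> 0"
proof (rule LIMSEQ_I)
  fix e :: real
  assume "0 < e"
  then obtain j0 where j0: "\<And>j. j \<ge> j0 \<Longrightarrow> norm (r (s j)) < e"
    using LIMSEQ_D[OF s(2)] by auto
  define k0 where "k0 = s (max j0 K)"
  have k0: "K \<le> k0" "r k0 < e"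
    using seq_suble[OF s(1), of "max j0 K"] j0[of "max j0 K"] by (auto simp: k0_def)
  have "r k \<le> r k0" if "k0 \<le> k" for k
    using that by (induction k rule: dec_induct) (use dec k0 in \<open>auto intro: order_trans\<close>)
  then have "\<forall>k\<ge>k0. norm (r k - 0) < e"
    using k0 pos by fastforce
  then show "\<exists>no. \<forall>n\<ge>no. norm (r n - 0) < e" by blast
qed

section \<open>Runs of the algorithm\<close>

text \<open>Collects the facts about a run that involve neither the limit point nor the KL
  property.\<close>

locale ipalm =
  fixes F :: "real ^ 'n ^ 'm \<Rightarrow> real"
    and q p lam0 varrho betmax l L delbeta :: real
    and lam del L1 L2 bet :: "nat \<Rightarrow> real"
    and lam1 lam2 :: "nat \<Rightarrow> 'd::finite \<Rightarrow> real"
    and N :: nat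
    and U :: "nat \<Rightarrow> real ^ 'd ^ 'm"
    and V :: "nat \<Rightarrow> real ^ 'd ^ 'n"
  assumes qp: "0 < q" "q \<le> 2" "0 < p" "p \<le> 2"
    and run: "ipalm_run F q p lam0 varrho betmax lam del L1 L2 bet lam1 lam2 N U V"
    and F_diff: "continuously_differentiable F"
    and lipschitz_U: "\<And>k. N \<le> k \<Longrightarrow> (L1 k / 2)-lipschitz_on UNIV (\<lambda>X. grad_U F X (V k))"
    and lipschitz_V: "\<And>k. N \<le> k \<Longrightarrow> (L2 k / 2)-lipschitz_on UNIV (\<lambda>Y. grad_V F (U (k + 1)) Y)"
    and l_pos: "0 < l"
    and bounds: "\<And>k. N \<le> k \<Longrightarrow> l \<le> L1 k \<and> L1 k \<le> L \<and> l \<le> L2 k \<and> L2 k \<le> L"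
    and delbeta_less: "delbeta < 1"
    and weights: "\<And>k. N \<le> k \<Longrightarrow> 1 \<le> k \<Longrightarrow> 0 \<le> bet k \<and>
         bet k \<le> 1 / 6 * delbeta * min (sqrt (L1 (k - 1) / L1 k)) (sqrt (L2 (k - 1) / L2 k))"
begin

abbreviation z :: "nat \<Rightarrow> (real ^ 'd ^ 'm) \<times> (real ^ 'd ^ 'n)" where
  "z k \<equiv> (U k, V k)"

abbreviation P :: "nat \<Rightarrow> (real ^ 'd ^ 'm) \<times> (real ^ 'd ^ 'n) \<Rightarrow> real" where
  "P \<equiv> Phi_pert F q p lam1 lam2"

text \<open>The coefficients are the surplus \<open>c / 8\<close> that the descent of each block
  leaves; index \<open>k\<close> belongs to the step from iterate \<open>k\<close> to iterate
  \<open>Suc k\<close>.\<close>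

definition A :: "nat \<Rightarrow> real" where
  "A k = L1 k / 8 * (norm (U (Suc k) - U k))\<^sup>2 + L2 k / 8 * (norm (V (Suc k) - V k))\<^sup>2"

lemma L_pos: "0 < L1 k" "0 < L2 k"
  using run by (auto simp: ipalm_run_def)

lemma lam0_pos: "0 < lam0"
  using run by (auto simp: ipalm_run_def)

lemma bet: "0 \<le> bet k" "bet k \<le> betmax"
  using run by (auto simp: ipalm_run_def)

lemma del: "0 \<le> del k" "del k \<le> 1 / 4" "del \<longlonglongrightarrow> 0" "summable del"
  using run by (auto simp: ipalm_run_def)

lemma columns_nonzero: "N \<le> k \<Longrightarrow> 0 < k \<Longrightarrow> column t (U k) \<noteq> 0" "N \<le> k \<Longrightarrow> 0 < k \<Longrightarrow> column t (V k) \<noteq> 0"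
  using run by (auto simp: ipalm_run_def)

lemma A_nonneg: "0 \<le> A k"
  using L_pos[of k] by (simp add: A_def)

lemma block_U:
  assumes "N \<le> k"
  shows "block_step (\<lambda>X. F (X ** transpose (V k))) (\<lambda>X. grad_U F X (V k)) (L1 k) q (bet k) (lam1 k)
    (U (k - 1)) (U k) (U (Suc k)) (extrapolate bet U k)"
proof
  show "GDERIV (\<lambda>X. F (X ** transpose (V k))) X :> grad_U F X (V k)" for X
    using F_diff by (rule GDERIV_grad_U)
  show "column t (U (Suc k)) \<in> prox (\<lambda>x. lam1 k t / (q * L1 k) * norm x powr q)
      (column t (extrapolate bet U k - (1 / L1 k) *\<^sub>R grad_U F (extrapolate bet U k) (V k)))" for t
    using run assms by (simp add: ipalm_run_def)
qed (use assms lipschitz_U L_pos qp bet in \<open>auto simp: extrapolate_def\<close>)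

lemma block_V:
  assumes "N \<le> k"
  shows "block_step (\<lambda>Y. F (U (Suc k) ** transpose Y)) (\<lambda>Y. grad_V F (U (Suc k)) Y) (L2 k) p (bet k)
    (lam2 k) (V (k - 1)) (V k) (V (Suc k)) (extrapolate bet V k)"
proof
  show "GDERIV (\<lambda>Y. F (U (Suc k) ** transpose Y)) Y :> grad_V F (U (Suc k)) Y" for Y
    using F_diff by (rule GDERIV_grad_V)
  show "column t (V (Suc k)) \<in> prox (\<lambda>x. lam2 k t / (p * L2 k) * norm x powr p)
      (column t (extrapolate bet V k - (1 / L2 k) *\<^sub>R grad_V F (U (Suc k)) (extrapolate bet V k)))" for t
    using run assms by (simp add: ipalm_run_def)
qed (use assms lipschitz_V L_pos qp bet in \<open>auto simp: extrapolate_def\<close>)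

section \<open>Extrapolation weights and descent\<close>

lemma delbeta_nonneg: "0 \<le> delbeta"
proof -
  have "0 < min (sqrt (L1 N / L1 (Suc N))) (sqrt (L2 N / L2 (Suc N)))"
    using L_pos by simp
  moreover have "0 \<le> delbeta / 6 * min (sqrt (L1 N / L1 (Suc N))) (sqrt (L2 N / L2 (Suc N)))"
    using weights[of "Suc N"] by auto
  ultimately show ?thesis
    by (simp add: zero_le_mult_iff not_le[symmetric] del: min_less_iff_conj)
qed

text \<open>The factor 1/6 in the bound on the weights is made for this:
  \<open>9 / 2 / 36 = 1 / 8\<close>, so the cost of extrapolation is at most
  \<open>delbeta\<^sup>2\<close> times the surplus of the previous step.\<close>

lemma bet_bound:
  assumes "N \<le> k" "1 \<le> k"
  shows "9 / 2 * L1 k * (bet k)\<^sup>2 \<le> delbeta\<^sup>2 * (L1 (k - 1) / 8)"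
    "9 / 2 * L2 k * (bet k)\<^sup>2 \<le> delbeta\<^sup>2 * (L2 (k - 1) / 8)"
proof -
  have main: "9 / 2 * y * b\<^sup>2 \<le> delbeta\<^sup>2 * (x / 8)"
    if "0 < x" "0 < y" "0 \<le> b" "b \<le> 1 / 6 * delbeta * sqrt (x / y)" for x y b
  proof -
    have "b\<^sup>2 \<le> (1 / 6 * delbeta * sqrt (x / y))\<^sup>2"
      using that by (intro power_mono) auto
    also have "\<dots> = delbeta\<^sup>2 / 36 * (x / y)"
      using that by (simp add: power_mult_distrib power_divide)
    finally have "9 / 2 * y * b\<^sup>2 \<le> 9 / 2 * y * (delbeta\<^sup>2 / 36 * (x / y))"
      using that by (intro mult_left_mono) auto
    then show ?thesis using that by (simp add: mult.commute)
  qed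
  have "1 / 6 * delbeta * min (sqrt (L1 (k - 1) / L1 k)) (sqrt (L2 (k - 1) / L2 k))
      \<le> 1 / 6 * delbeta * sqrt (L1 (k - 1) / L1 k)"
    "1 / 6 * delbeta * min (sqrt (L1 (k - 1) / L1 k)) (sqrt (L2 (k - 1) / L2 k))
      \<le> 1 / 6 * delbeta * sqrt (L2 (k - 1) / L2 k)"
    using delbeta_nonneg by (intro mult_left_mono; simp)+
  with weights[OF assms] have "bet k \<le> 1 / 6 * delbeta * sqrt (L1 (k - 1) / L1 k)"
    "bet k \<le> 1 / 6 * delbeta * sqrt (L2 (k - 1) / L2 k)"
    by linarith+
  then show "9 / 2 * L1 k * (bet k)\<^sup>2 \<le> delbeta\<^sup>2 * (L1 (k - 1) / 8)"
    "9 / 2 * L2 k * (bet k)\<^sup>2 \<le> delbeta\<^sup>2 * (L2 (k - 1) / 8)"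
    using L_pos bet(1)[of k] by (intro main; simp)+
qed

text \<open>The two block descents are added; the value of \<open>F\<close> at the new
  \<open>U\<close> and the old \<open>V\<close> cancels. \<open>P (Suc (Suc k))\<close> carries
  precisely the weights of the subproblems of iteration \<open>Suc k\<close>.\<close>

lemma descent:
  assumes "N \<le> k"
  shows "P (Suc (Suc k)) (z (Suc (Suc k))) + A (Suc k) \<le> P (Suc (Suc k)) (z (Suc k)) + delbeta\<^sup>2 * A k"
proof -
  let ?k = "Suc k"
  have k: "N \<le> ?k" "1 \<le> ?k" using assms by auto
  have mono: "9 / 2 * L1 ?k * (bet ?k)\<^sup>2 * (norm (U ?k - U k))\<^sup>2
        \<le> delbeta\<^sup>2 * (L1 k / 8) * (norm (U ?k - U k))\<^sup>2"
      "9 / 2 * L2 ?k * (bet ?k)\<^sup>2 * (norm (V ?k - V k))\<^sup>2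
        \<le> delbeta\<^sup>2 * (L2 k / 8) * (norm (V ?k - V k))\<^sup>2"
    using bet_bound[OF k] by (intro mult_right_mono; simp)+
  show ?thesis
    using block_step.descent[OF block_U[OF k(1)]] block_step.descent[OF block_V[OF k(1)]] mono
    unfolding A_def Phi_pert_def Phi_weighted_eq_pen
    by (simp add: algebra_simps)
qed

lemma dist_le_sqrt_A:
  assumes "N \<le> k"
  shows "dist (z (Suc k)) (z k) \<le> sqrt (8 / l) * sqrt (A k)"
proof -
  have "(norm (U (Suc k) - U k))\<^sup>2 + (norm (V (Suc k) - V k))\<^sup>2
      = 8 / l * (l / 8 * (norm (U (Suc k) - U k))\<^sup>2 + l / 8 * (norm (V (Suc k) - V k))\<^sup>2)"
    using l_pos by (simp add: distrib_left[symmetric])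
  also have "\<dots> \<le> 8 / l * A k"
    unfolding A_def using l_pos bounds[OF assms]
    by (intro mult_left_mono add_mono mult_right_mono divide_right_mono) auto
  finally have "sqrt ((norm (U (Suc k) - U k))\<^sup>2 + (norm (V (Suc k) - V k))\<^sup>2) \<le> sqrt (8 / l * A k)"
    by (rule real_sqrt_le_mono)
  then show ?thesis
    unfolding dist_Pair_Pair by (simp only: dist_norm real_sqrt_mult[symmetric])
qed

section \<open>Gradient of the perturbed objective at the iterates\<close>

definition grad_P :: "nat \<Rightarrow> (real ^ 'd ^ 'm) \<times> (real ^ 'd ^ 'n)" where
  "grad_P k = (grad_U F (U k) (V k) + pen_grad (lam1 (k - 1)) q (U k),
               grad_V F (U k) (V k) + pen_grad (lam2 (k - 1)) p (V k))"

lemma GDERIV_P: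
  assumes "N \<le> k" "0 < k"
  shows "GDERIV (P k) (z k) :> grad_P k"
  unfolding Phi_pert_def grad_P_def
  using F_diff qp columns_nonzero assms by (intro GDERIV_Phi_weighted) auto

text \<open>Stationarity of the subproblems trades the penalty gradients for differences of smooth
  gradients and prox residuals, all controlled by the last two steps.\<close>

lemma norm_grad_P_le:
  assumes k: "N \<le> k"
    and C: "C-lipschitz_on S (\<lambda>(X, Y). grad_U F X Y)" "z k \<in> S" "z (Suc k) \<in> S"
  shows "norm (grad_P (Suc k))
    \<le> (C + 3 * L + 4 * L * betmax) * (dist (z (Suc k)) (z k) + dist (z k) (z (k - 1)))"
proof -
  interpret u: block_step "\<lambda>X. F (X ** transpose (V k))" "\<lambda>X. grad_U F X (V k)" "L1 k" q "bet k" "lam1 k"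
    "U (k - 1)" "U k" "U (Suc k)" "extrapolate bet U k"
    using k by (rule block_U)
  interpret v: block_step "\<lambda>Y. F (U (Suc k) ** transpose Y)" "\<lambda>Y. grad_V F (U (Suc k)) Y" "L2 k" p "bet k"
    "lam2 k" "V (k - 1)" "V k" "V (Suc k)" "extrapolate bet V k"
    using k by (rule block_V)
  define d d' where "d = dist (z (Suc k)) (z k)" and "d' = dist (z k) (z (k - 1))"
  have d: "norm (U (Suc k) - U k) \<le> d" "norm (V (Suc k) - V k) \<le> d"
      "norm (U k - U (k - 1)) \<le> d'" "norm (V k - V (k - 1)) \<le> d'" "0 \<le> d" "0 \<le> d'"
    using dist_fst_le[of "z (Suc k)" "z k"] dist_snd_le[of "z (Suc k)" "z k"]
      dist_fst_le[of "z k" "z (k - 1)"] dist_snd_le[of "z k" "z (k - 1)"]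
    by (auto simp: d_def d'_def dist_norm)
  have L: "0 < L" "L1 k \<le> L" "L2 k \<le> L" and b: "0 \<le> betmax"
    using bounds[OF k] l_pos bet[of 0] by auto
  have step: "bet k * x \<le> betmax * d'" if "x \<le> d'" "0 \<le> x" for x
    using bet that b by (intro mult_mono) auto
  define X Y where "X = extrapolate bet U k" and "Y = extrapolate bet V k"
  have nX: "norm (X - U (Suc k)) \<le> d + betmax * d'"
    using u.norm_Y_diff_le d step[of "norm (U k - U (k - 1))"] by (simp add: X_def)
  have nY: "norm (Y - V (Suc k)) \<le> d + betmax * d'"
    using v.norm_Y_diff_le d step[of "norm (V k - V (k - 1))"] by (simp add: Y_def)
  have L_mult: "c * x \<le> L * y" if "c \<le> L" "x \<le> y" "0 \<le> x" for c x y
    using that L by (intro mult_mono) auto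
  \<comment> \<open>The \<open>U\<close> subproblem used the old \<open>V k\<close>, so the joint
    Lipschitz constant is needed between \<open>z k\<close> and \<open>z (Suc k)\<close>. The
    extrapolated point may lie outside \<open>S\<close>; it is reached from \<open>U k\<close> by
    the global Lipschitz constant of the block.\<close>
  have "fst (grad_P (Suc k)) = (grad_U F (U (Suc k)) (V (Suc k)) - grad_U F (U k) (V k))
      + (grad_U F (U k) (V k) - grad_U F X (V k)) + L1 k *\<^sub>R (X - U (Suc k))"
    using u.stationary columns_nonzero k by (simp add: grad_P_def X_def)
  then have "norm (fst (grad_P (Suc k))) \<le> norm (grad_U F (U (Suc k)) (V (Suc k)) - grad_U F (U k) (V k))
      + norm (grad_U F (U k) (V k) - grad_U F X (V k)) + norm (L1 k *\<^sub>R (X - U (Suc k)))"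
    by (simp only:) (intro norm_triangle_le add_right_mono norm_triangle_ineq)
  also have "norm (grad_U F (U (Suc k)) (V (Suc k)) - grad_U F (U k) (V k)) \<le> C * d"
    using lipschitz_onD[OF C(1,3,2)] by (simp add: d_def dist_norm)
  also have "norm (grad_U F (U k) (V k) - grad_U F X (V k)) \<le> L * (betmax * d')"
  proof -
    have "norm (grad_U F (U k) (V k) - grad_U F X (V k)) \<le> L1 k / 2 * dist (U k) X"
      using lipschitz_onD[OF u.lipschitz_G, of "U k" X] by (simp add: dist_norm)
    also have "dist (U k) X = bet k * norm (U k - U (k - 1))"
      using bet by (simp add: X_def extrapolate_def dist_norm)
    also have "L1 k / 2 * (bet k * norm (U k - U (k - 1))) \<le> L * (betmax * d')"
      using step[of "norm (U k - U (k - 1))"] d L bet[of k] L_pos[of k] by (intro L_mult) auto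
    finally show ?thesis .
  qed
  also have "norm (L1 k *\<^sub>R (X - U (Suc k))) \<le> L * (d + betmax * d')"
    using nX L L_pos[of k] by (auto intro!: L_mult)
  finally have 1: "norm (fst (grad_P (Suc k))) \<le> C * d + L * (betmax * d') + L * (d + betmax * d')"
    by simp
  \<comment> \<open>The \<open>V\<close> subproblem already used \<open>U (Suc k)\<close>, so here
    the Lipschitz constant of the block is enough.\<close>
  have "snd (grad_P (Suc k)) = (grad_V F (U (Suc k)) (V (Suc k)) - grad_V F (U (Suc k)) Y)
      + L2 k *\<^sub>R (Y - V (Suc k))"
    using v.stationary columns_nonzero k by (simp add: grad_P_def Y_def)
  then have "norm (snd (grad_P (Suc k))) \<le> norm (grad_V F (U (Suc k)) (V (Suc k)) - grad_V F (U (Suc k)) Y)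
      + norm (L2 k *\<^sub>R (Y - V (Suc k)))"
    by (simp only: norm_triangle_ineq)
  also have "norm (grad_V F (U (Suc k)) (V (Suc k)) - grad_V F (U (Suc k)) Y) \<le> L * (d + betmax * d')"
  proof -
    have "norm (grad_V F (U (Suc k)) (V (Suc k)) - grad_V F (U (Suc k)) Y) \<le> L2 k / 2 * dist (V (Suc k)) Y"
      using lipschitz_onD[OF v.lipschitz_G, of "V (Suc k)" Y] by (simp add: dist_norm)
    also have "\<dots> \<le> L * (d + betmax * d')"
      using nY L L_pos[of k] by (intro L_mult) (auto simp: dist_norm norm_minus_commute)
    finally show ?thesis .
  qed
  also have "norm (L2 k *\<^sub>R (Y - V (Suc k))) \<le> L * (d + betmax * d')"
    using nY L L_pos[of k] by (auto intro!: L_mult)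
  finally have 2: "norm (snd (grad_P (Suc k))) \<le> L * (d + betmax * d') + L * (d + betmax * d')"
    by simp
  have "norm (grad_P (Suc k)) \<le> norm (fst (grad_P (Suc k))) + norm (snd (grad_P (Suc k)))"
    using norm_Pair_le[of "fst (grad_P (Suc k))" "snd (grad_P (Suc k))"] by simp
  also have "\<dots> \<le> (C + 3 * L) * d + 4 * L * betmax * d'"
    using 1 2 by (simp add: algebra_simps)
  also have "\<dots> \<le> (C + 3 * L + 4 * L * betmax) * d + (C + 3 * L + 4 * L * betmax) * d'"
  proof -
    have "0 \<le> C" "0 \<le> L * betmax"
      using lipschitz_on_nonneg[OF C(1)] L b by auto
    then show ?thesis
      using L d by (intro add_mono[of "(C + 3 * L) * d"] mult_right_mono) auto
  qed
  also have "\<dots> = (C + 3 * L + 4 * L * betmax) * (d + d')"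
    by (simp add: distrib_left)
  finally show ?thesis
    by (simp add: d_def d'_def)
qed

section \<open>Stabilization of the weights\<close>

lemma lam_eventually_eq: "\<exists>K. \<forall>k\<ge>K. lam k = lam0"
proof -
  have par: "0 < varrho" "varrho < 1" and lam_Suc: "lam (Suc k) = max (varrho * lam k) lam0" for k
    using run by (auto simp: ipalm_run_def)
  \<comment> \<open>Geometric decay down to the floor \<open>lam0\<close>: the first entry falls
    below \<open>lam0\<close> after finitely many iterations.\<close>
  have "lam k \<le> max (varrho ^ k * lam 0) lam0" for k
  proof (induction k)
    case (Suc k)
    have "varrho * lam k \<le> varrho * max (varrho ^ k * lam 0) lam0"
      using Suc par by (intro mult_left_mono) auto
    also have "\<dots> = max (varrho ^ Suc k * lam 0) (varrho * lam0)"
      using par by (simp add: max_mult_distrib_left mult.assoc)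
    also have "\<dots> \<le> max (varrho ^ Suc k * lam 0) lam0"
      using par lam0_pos by (intro max.mono) auto
    finally show ?case
      by (simp add: lam_Suc)
  qed simp
  moreover have "(\<lambda>k. varrho ^ k * lam 0) \<longlonglongrightarrow> 0"
    using par tendsto_mult_right[OF LIMSEQ_realpow_zero[of varrho], of "lam 0"] by simp
  then have "eventually (\<lambda>k. varrho ^ k * lam 0 < lam0) sequentially"
    using lam0_pos by (rule order_tendstoD)
  then obtain K where K: "\<And>k. K \<le> k \<Longrightarrow> varrho ^ k * lam 0 < lam0"
    unfolding eventually_sequentially by blast
  ultimately have "lam k \<le> lam0" if "K \<le> k" for k
    using that by (metis less_imp_le max.absorb2)
  moreover have "lam0 \<le> lam (Suc k)" for k
    by (simp add: lam_Suc)
  ultimately have "\<forall>k\<ge>Suc K. lam k = lam0"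
    by (metis Suc_le_D Suc_leD antisym)
  then show ?thesis by blast
qed

lemma weights_close:
  assumes "N \<le> k" "lam k = lam0"
  shows "\<bar>lam1 k t - lam0\<bar> \<le> 7 * del k * lam0" "lam0 / 2 \<le> lam1 k t"
    "\<bar>lam2 k t - lam0\<bar> \<le> 7 * del k * lam0" "lam0 / 2 \<le> lam2 k t"
  using weight_close[of lam0 "lam1 k t" q "del k"] weight_close[of lam0 "lam2 k t" p "del k"]
    run assms qp lam0_pos del(2)[of k]
  by (auto simp: ipalm_run_def)

lemma weights_tendsto: "(\<lambda>k. lam1 k t) \<longlonglongrightarrow> lam0" "(\<lambda>k. lam2 k t) \<longlonglongrightarrow> lam0"
proof -
  obtain K where K: "\<And>k. K \<le> k \<Longrightarrow> lam k = lam0"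
    using lam_eventually_eq by blast
  have 0: "(\<lambda>k. 7 * del k * lam0) \<longlonglongrightarrow> 0"
    using tendsto_mult_right[OF tendsto_mult_left[OF del(3)], of 7 lam0] by simp
  have "eventually (\<lambda>k. norm (lam1 k t - lam0) \<le> 7 * del k * lam0) sequentially"
    "eventually (\<lambda>k. norm (lam2 k t - lam0) \<le> 7 * del k * lam0) sequentially"
    using weights_close K unfolding eventually_sequentially real_norm_def
    by (metis max.bounded_iff)+
  from this[THEN Lim_null_comparison, OF 0]
  show "(\<lambda>k. lam1 k t) \<longlonglongrightarrow> lam0" "(\<lambda>k. lam2 k t) \<longlonglongrightarrow> lam0"
    by (auto simp: LIM_zero_iff)
qed

text \<open>The penalty part of \<open>P k\<close>, through which alone a change of the weights
  acts.\<close>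

definition R :: "nat \<Rightarrow> (real ^ 'd ^ 'm) \<times> (real ^ 'd ^ 'n) \<Rightarrow> real" where
  "R k x = pen (lam1 (k - 1)) q (fst x) + pen (lam2 (k - 1)) p (snd x)"

lemma P_eq: "P k x = F (fst x ** transpose (snd x)) + R k x"
  by (cases x) (simp add: Phi_pert_def Phi_weighted_eq_pen R_def)

lemma P_Suc_diff_le:
  assumes "N \<le> k" "lam k = lam0" "lam (Suc k) = lam0"
  shows "\<bar>P (Suc k) x - P (Suc (Suc k)) x\<bar> \<le> 14 * (del k + del (Suc k)) * R (Suc k) x"
proof -
  have "\<bar>lam1 k t - lam1 (Suc k) t\<bar> \<le> 14 * (del k + del (Suc k)) * lam1 k t"
    "\<bar>lam2 k t - lam2 (Suc k) t\<bar> \<le> 14 * (del k + del (Suc k)) * lam2 k t" for t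
  proof -
    \<comment> \<open>Passing from an error relative to \<open>lam0\<close> to one relative to the
      weight \<open>a \<ge> lam0 / 2\<close> doubles 7 to 14.\<close>
    have *: "\<bar>a - b\<bar> \<le> 14 * (x + y) * a"
      if "\<bar>a - lam0\<bar> \<le> 7 * x * lam0" "\<bar>b - lam0\<bar> \<le> 7 * y * lam0" "lam0 / 2 \<le> a"
        "0 \<le> x" "0 \<le> y" for a b x y
    proof -
      have "\<bar>a - b\<bar> \<le> (14 * (x + y)) * (lam0 / 2)"
        using that by (simp add: algebra_simps)
      also have "\<dots> \<le> (14 * (x + y)) * a"
        using that by (intro mult_left_mono) auto
      finally show ?thesis .
    qed
    show "\<bar>lam1 k t - lam1 (Suc k) t\<bar> \<le> 14 * (del k + del (Suc k)) * lam1 k t"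
      "\<bar>lam2 k t - lam2 (Suc k) t\<bar> \<le> 14 * (del k + del (Suc k)) * lam2 k t"
      using assms weights_close[of k] weights_close[of "Suc k"] del by (intro *; simp)+
  qed
  then have "\<bar>pen (lam1 k) q (fst x) - pen (lam1 (Suc k)) q (fst x)\<bar>
      \<le> 14 * (del k + del (Suc k)) * pen (lam1 k) q (fst x)"
    "\<bar>pen (lam2 k) p (snd x) - pen (lam2 (Suc k)) p (snd x)\<bar>
      \<le> 14 * (del k + del (Suc k)) * pen (lam2 k) p (snd x)"
    using qp by (intro pen_diff_le; simp)+
  then show ?thesis
    by (simp add: P_eq R_def distrib_left abs_le_iff)
qed

lemma R_nonneg: "N < k \<Longrightarrow> 0 \<le> R k x"
  unfolding R_def using run qp
  by (intro add_nonneg_nonneg pen_nonneg) (auto simp: ipalm_run_def intro: less_imp_le)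

text \<open>Tolerances of at most 1/4 give a relative error of at most 7/4, hence weights of at most
  \<open>3 * lam0\<close>.\<close>

lemma R_le:
  assumes "N < k" "lam (k - 1) = lam0"
  shows "R k x \<le> 3 * (pen (\<lambda>_. lam0) q (fst x) + pen (\<lambda>_. lam0) p (snd x))"
proof -
  have "7 * del (k - 1) * lam0 \<le> 2 * lam0"
    using del(2)[of "k - 1"] lam0_pos by (intro mult_right_mono) auto
  moreover have "N \<le> k - 1" using assms(1) by simp
  ultimately have "\<bar>lam0 - lam1 (k - 1) t\<bar> \<le> 2 * lam0" "\<bar>lam0 - lam2 (k - 1) t\<bar> \<le> 2 * lam0" for t
    using weights_close[of "k - 1" t] assms(2) by linarith+
  then have "\<bar>pen (\<lambda>_. lam0) q (fst x) - pen (lam1 (k - 1)) q (fst x)\<bar> \<le> 2 * pen (\<lambda>_. lam0) q (fst x)"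
    "\<bar>pen (\<lambda>_. lam0) p (snd x) - pen (lam2 (k - 1)) p (snd x)\<bar> \<le> 2 * pen (\<lambda>_. lam0) p (snd x)"
    using qp by (intro pen_diff_le; simp)+
  then show ?thesis by (simp add: R_def)
qed

end

theorem theorem5p3:
  fixes F :: "real ^ 'n ^ 'm \<Rightarrow> real"
    and q p lam0 varrho betmax l L delbeta \<rho> \<theta> \<mu> :: real
    and \<eta> :: ereal
    and lam del L1 L2 bet :: "nat \<Rightarrow> real"
    and lam1 lam2 :: "nat \<Rightarrow> 'd::finite \<Rightarrow> real"
    and N :: nat
    and U :: "nat \<Rightarrow> real ^ 'd ^ 'm"
    and V :: "nat \<Rightarrow> real ^ 'd ^ 'n"
    and Ub :: "real ^ 'd ^ 'm"
    and Vb :: "real ^ 'd ^ 'n"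
  assumes "0 < q" "q \<le> 2" "0 < p" "p \<le> 2"
    and run: "ipalm_run F q p lam0 varrho betmax lam del L1 L2 bet lam1 lam2 N U V"
    and tol: "summable (\<lambda>k. sqrt (del k))"
    and A1: "continuously_differentiable F" "bdd_below (range F)"
    and A2: "\<exists>z :: (real ^ 'd ^ 'm) \<times> (real ^ 'd ^ 'n). critical_point (Phi F q p lam0) z"
    and A3_lipschitz:
      "\<forall>k\<ge>N. (L1 k / 2)-lipschitz_on UNIV (\<lambda>X. grad_U F X (V k))"
      "\<forall>k\<ge>N. (L2 k / 2)-lipschitz_on UNIV (\<lambda>Y. grad_V F (U (k + 1)) Y)"
    and A3_bounds:
      "0 < l" "l < L"
      "\<forall>k\<ge>N. l \<le> L1 k \<and> L1 k \<le> L \<and> l \<le> L2 k \<and> L2 k \<le> L"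
    and C_descent:
      "\<forall>k\<ge>N. Phi_pert F q p lam1 lam2 (k + 1) (U (k + 1), V (k + 1))
              \<le> Phi_pert F q p lam1 lam2 (k + 1) (U k, V k)"
    and C_weights:
      "delbeta < 1"
      "\<forall>k\<ge>N. 1 \<le> k \<longrightarrow> 0 \<le> bet k \<and>
         bet k \<le> 1 / 6 * delbeta * min (sqrt (L1 (k - 1) / L1 k)) (sqrt (L2 (k - 1) / L2 k))"
    and limit_point: "\<exists>r. strict_mono r \<and> (\<lambda>j. (U (r j), V (r j))) \<longlonglongrightarrow> (Ub, Vb)"
    and cond1:
      "\<exists>C. C-lipschitz_on (cball (Ub, Vb) (4 * \<rho>)) (\<lambda>(X, Y). grad_U F X Y)"
      "\<exists>C. C-lipschitz_on (cball (Ub, Vb) (4 * \<rho>)) (\<lambda>(X, Y). grad_V F X Y)"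
    and cond2:
      "\<exists>K>N. \<forall>k\<ge>K.
         Phi_pert F q p lam1 lam2 k (U k, V k) - Phi_pert F q p lam1 lam2 k (Ub, Vb)
           \<ge> Phi_pert F q p lam1 lam2 (k + 1) (U (k + 1), V (k + 1))
             - Phi_pert F q p lam1 lam2 (k + 1) (Ub, Vb) \<and>
         Phi_pert F q p lam1 lam2 (k + 1) (U (k + 1), V (k + 1))
           - Phi_pert F q p lam1 lam2 (k + 1) (Ub, Vb) > 0"
    and cond3:
      "\<exists>K>N. \<forall>k\<ge>K. KL_property (Phi_pert F q p lam1 lam2 k) (Ub, Vb) \<rho> \<eta> \<theta> \<mu>"
  shows "(\<lambda>k. (U k, V k)) \<longlonglongrightarrow> (Ub, Vb) \<and> critical_point (Phi F q p lam0) (Ub, Vb)"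
proof -
  interpret ipalm F q p lam0 varrho betmax l L delbeta lam del L1 L2 bet lam1 lam2 N U V
    using assms(1-4) run A1 A3_lipschitz A3_bounds C_weights by unfold_locales auto
  define zb where "zb = (Ub, Vb)"
  define r where "r k = P k (z k) - P k zb" for k
  obtain K1 where K1: "\<And>k. K1 \<le> k \<Longrightarrow> lam k = lam0"
    using lam_eventually_eq by blast
  obtain K2 where K2: "N < K2" "\<And>k. K2 \<le> k \<Longrightarrow> r (Suc k) \<le> r k" "\<And>k. K2 \<le> k \<Longrightarrow> 0 < r (Suc k)"
    using cond2 unfolding r_def zb_def by auto
  obtain K3 where K3: "N < K3" "\<And>k. K3 \<le> k \<Longrightarrow> KL_property (P k) zb \<rho> \<eta> \<theta> \<mu>"
    using cond3 unfolding zb_def by auto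
  have \<rho>\<eta>: "0 < \<rho>" "0 < \<eta>"
    using K3(2)[of K3] by (auto simp: KL_property_def)
  obtain s where s: "strict_mono s" "(\<lambda>j. z (s j)) \<longlonglongrightarrow> zb"
    using limit_point by (auto simp: zb_def)
  obtain B where B: "\<And>X. B \<le> F X"
    using A1(2) by (auto simp: bdd_below_def)

  \<comment> \<open>Vanishing of the gap to the limit value\<close>
  have r0: "r \<longlonglongrightarrow> 0"
  proof (rule decseq_from_tendsto_0_subseq)
    \<comment> \<open>Condition 2 states positivity for the successor index, hence the start at
      \<open>Suc K2\<close>.\<close>
    show "0 \<le> r k" if "Suc K2 \<le> k" for k
      using that K2(3)[of "k - 1"] by (cases k) auto
    show "r (Suc k) \<le> r k" if "Suc K2 \<le> k" for k
      using that K2(2) by simp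
    have pred: "filterlim (\<lambda>j. s j - 1) sequentially sequentially"
      using filterlim_compose[OF filterlim_minus_const_nat_at_top filterlim_subseq[OF s(1)]] .
    have w: "(\<lambda>j. lam1 (s j - 1) t) \<longlonglongrightarrow> lam0" "(\<lambda>j. lam2 (s j - 1) t) \<longlonglongrightarrow> lam0" for t
      using filterlim_compose[OF weights_tendsto(1) pred] filterlim_compose[OF weights_tendsto(2) pred]
      by auto
    \<comment> \<open>Along the subsequence iterates and weights converge, so both values tend to
      the same number.\<close>
    have "(\<lambda>j. P (s j) (z (s j)) - P (s j) zb)
        \<longlonglongrightarrow> Phi_weighted F q p (\<lambda>_. lam0) (\<lambda>_. lam0) zb - Phi_weighted F q p (\<lambda>_. lam0) (\<lambda>_. lam0) zb"
      unfolding Phi_pert_def zb_def using s(2) w qp F_diff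
      by (intro tendsto_diff tendsto_Phi_weighted) (auto simp: zb_def)
    then show "(r \<circ> s) \<longlonglongrightarrow> 0"
      by (simp add: r_def[abs_def] o_def)
  qed (rule s(1))

  have "(\<lambda>k. ereal (r k)) \<longlonglongrightarrow> ereal 0"
    using r0 by (rule tendsto_ereal)
  then have "eventually (\<lambda>k. ereal (r k) < \<eta>) sequentially"
    using \<rho>\<eta> by (intro order_tendstoD(2)) (auto simp: zero_ereal_def)
  then obtain K4 where K4: "\<And>k. K4 \<le> k \<Longrightarrow> ereal (r k) < \<eta>"
    by (auto simp: eventually_sequentially)
  define K where "K = Suc (max (max K1 K2) (max K3 K4))"
  have KN: "N < k" and K: "lam k = lam0" "lam (k - 1) = lam0" "0 < r k" "r (Suc k) \<le> r k"
    "KL_property (P k) zb \<rho> \<eta> \<theta> \<mu>" "ereal (r k) < \<eta>" if "K \<le> k" for k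
    using that K1 K2(1,2) K2(3)[of "k - 1"] K3 K4 by (auto simp: K_def)

  have r_le: "r k \<le> r K" if "K \<le> k" for k
    using that by (induction k rule: dec_induct) (use order_trans[OF K(4)] in auto)
  define R0 where "R0 = 3 * (pen (\<lambda>_. lam0) q (fst zb) + pen (\<lambda>_. lam0) p (snd zb))"
  \<comment> \<open>A common bound for the penalty at the limit point and at all late iterates, so
    that a change of weights costs at most \<open>M\<close> times the tolerances.\<close>
  define M where "M = max R0 (F (Ub ** transpose Vb) + R0 + r K - B)"
  have R_zb: "R k zb \<le> R0" if "K \<le> k" for k
    unfolding R0_def using K(2) KN that by (intro R_le) auto
  have RM: "R k zb \<le> M" "R k (z k) \<le> M" if "K \<le> k" for k
  proof -
    show "R k zb \<le> M" using R_zb[OF that] by (simp add: M_def)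
    \<comment> \<open>The penalty at an iterate is bounded because the gap decreases and
      \<open>F\<close> is bounded below.\<close>
    have "R k (z k) = r k + F (Ub ** transpose Vb) + R k zb - F (U k ** transpose (V k))"
      by (simp add: r_def P_eq zb_def)
    also have "\<dots> \<le> M"
      using r_le[OF that] R_zb[OF that] B[of "U k ** transpose (V k)"] by (simp add: M_def)
    finally show "R k (z k) \<le> M" .
  qed
  have M: "0 \<le> M"
    using R_nonneg[OF KN, of K zb] RM(1)[of K] by simp
  obtain C1 where C1: "C1-lipschitz_on (cball zb (4 * \<rho>)) (\<lambda>(X, Y). grad_U F X Y)"
    using cond1(1) by (auto simp: zb_def)
  obtain C2 where C2: "C2-lipschitz_on (cball zb (4 * \<rho>)) (\<lambda>(X, Y). grad_V F X Y)"
    using cond1(2) by (auto simp: zb_def)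
  define C where "C = C1 + 3 * L + 4 * L * betmax"
  have C: "0 \<le> C"
    using lipschitz_on_nonneg[OF C1] bet[of 0] A3_bounds(1,2) by (simp add: C_def)
  have grad_le: "norm (grad_P (Suc k)) \<le> C * (dist (z (Suc k)) (z k) + dist (z k) (z (k - 1)))"
    if "N \<le> k" "dist (z k) zb \<le> \<rho>" "dist (z (Suc k)) zb \<le> \<rho>" for k
    unfolding C_def using that \<rho>\<eta>
    by (intro norm_grad_P_le[OF _ C1]) (auto simp: dist_commute[of zb])

  \<comment> \<open>Convergence of the iterates\<close>
  have conv: "(\<lambda>j. z (j + K)) \<longlonglongrightarrow> zb"
  proof (rule KL_descent_convergence(2)[where \<Phi> = "\<lambda>j. P (j + K)" and A = "\<lambda>j. A (j + K)"
        and e = "\<lambda>j. 28 * M * (del (j + K) + del (Suc (j + K)))" and a = delbeta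
        and c = "sqrt (8 / l)" and C = "C * sqrt (8 / l)"])
    fix k
    define k' where "k' = k + K"
    have k': "K \<le> k'" by (simp add: k'_def)
    show "KL_property (P (k + K)) zb \<rho> \<eta> \<theta> \<mu>"
      using K(5) by simp
    show "0 < P (k + K) (z (k + K)) - P (k + K) zb" "ereal (P (k + K) (z (k + K)) - P (k + K) zb) < \<eta>"
      "P (Suc k + K) (z (Suc k + K)) - P (Suc k + K) zb \<le> P (k + K) (z (k + K)) - P (k + K) zb"
      using K(3,4,6)[of "k + K"] by (auto simp: r_def)
    show "0 \<le> A (k + K)" by (rule A_nonneg)
    show "0 \<le> 28 * M * (del (k + K) + del (Suc (k + K)))"
      using M del(1) by simp
    show "A (Suc k + K) \<le> delbeta\<^sup>2 * A (k + K) + 28 * M * (del (k + K) + del (Suc (k + K)))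
        + (P (Suc k + K) (z (Suc k + K)) - P (Suc k + K) zb
          - (P (Suc (Suc k) + K) (z (Suc (Suc k) + K)) - P (Suc (Suc k) + K) zb))"
    proof -
      define d where "d = 14 * (del k' + del (Suc k'))"
      have d: "0 \<le> d" using del(1) by (simp add: d_def)
      \<comment> \<open>Applied at the limit point and at the iterate \<open>Suc k'\<close>: two
        changes of weights with factor 14 each account for the constant 28 in the error.\<close>
      have diff: "\<bar>P (Suc k') x - P (Suc (Suc k')) x\<bar> \<le> d * M" if "R (Suc k') x \<le> M" for x
        unfolding d_def
        using P_Suc_diff_le[of k' x] KN[OF k'] K(1)[of k'] K(1)[of "Suc k'"] k' d[unfolded d_def]
          mult_left_mono[OF that d[unfolded d_def]] by simp
      have "P (Suc (Suc k')) (z (Suc (Suc k'))) + A (Suc k')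
          \<le> P (Suc (Suc k')) (z (Suc k')) + delbeta\<^sup>2 * A k'"
        using KN[OF k'] by (intro descent) simp
      then have "A (Suc k') \<le> delbeta\<^sup>2 * A k' + 2 * (d * M)
          + (P (Suc k') (z (Suc k')) - P (Suc k') zb
            - (P (Suc (Suc k')) (z (Suc (Suc k'))) - P (Suc (Suc k')) zb))"
        using diff[OF RM(1)] diff[OF RM(2)] k' by (simp add: abs_le_iff)
      moreover have "2 * (d * M) = 28 * M * (del k' + del (Suc k'))"
        by (simp add: d_def)
      ultimately show ?thesis by (simp add: k'_def)
    qed
    show "dist (z (Suc k + K)) (z (k + K)) \<le> sqrt (8 / l) * sqrt (A (k + K))"
      using dist_le_sqrt_A[of "k + K"] KN[of "k + K"] by simp
    show "\<exists>w \<in> limiting_subdiff (P (Suc (Suc k) + K)) (z (Suc (Suc k) + K)).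
        norm w \<le> C * sqrt (8 / l) * (sqrt (A (Suc k + K)) + sqrt (A (k + K)))"
      if "dist (z (Suc k + K)) zb \<le> \<rho>" "dist (z (Suc (Suc k) + K)) zb \<le> \<rho>"
    proof
      show "grad_P (Suc (Suc k) + K) \<in> limiting_subdiff (P (Suc (Suc k) + K)) (z (Suc (Suc k) + K))"
        using KN[OF k'] by (intro GDERIV_in_limiting_subdiff GDERIV_P) (simp_all add: k'_def)
      have "norm (grad_P (Suc (Suc k')))
          \<le> C * (dist (z (Suc (Suc k'))) (z (Suc k')) + dist (z (Suc k')) (z k'))"
        using grad_le[of "Suc k'"] that KN[OF k'] by (simp add: k'_def)
      also have "\<dots> \<le> C * (sqrt (8 / l) * sqrt (A (Suc k')) + sqrt (8 / l) * sqrt (A k'))"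
        using C KN[OF k'] by (intro mult_left_mono add_mono dist_le_sqrt_A) auto
      also have "\<dots> = C * sqrt (8 / l) * (sqrt (A (Suc k')) + sqrt (A k'))"
        by (simp add: distrib_left)
      finally show "norm (grad_P (Suc (Suc k) + K))
          \<le> C * sqrt (8 / l) * (sqrt (A (Suc k + K)) + sqrt (A (k + K)))"
        by (simp add: k'_def)
    qed
  next
    show "0 \<le> delbeta" by (rule delbeta_nonneg)
    show "delbeta < 1" by (rule delbeta_less)
    show "0 \<le> C * sqrt (8 / l)" "0 \<le> sqrt (8 / l)"
      using C l_pos by auto
    show "(\<lambda>k. P (k + K) (z (k + K)) - P (k + K) zb) \<longlonglongrightarrow> 0"
      using LIMSEQ_ignore_initial_segment[OF r0, of K] by (simp add: r_def)
    have shift: "summable (\<lambda>j. f (j + K))" "summable (\<lambda>j. f (Suc (j + K)))" if "summable f" for f :: "nat \<Rightarrow> real"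
      using summable_ignore_initial_segment[OF that, of K]
        summable_ignore_initial_segment[OF that, of "Suc K"] by simp_all
    show "summable (\<lambda>j. 28 * M * (del (j + K) + del (Suc (j + K))))"
      by (intro summable_mult summable_add shift del)
    \<comment> \<open>By subadditivity of the root, the summability of the roots of the tolerances
      carries over to the roots of the errors.\<close>
    have "summable (\<lambda>j. sqrt (28 * M) * (sqrt (del (j + K)) + sqrt (del (Suc (j + K)))))"
      by (intro summable_mult summable_add shift[OF tol])
    then show "summable (\<lambda>j. sqrt (28 * M * (del (j + K) + del (Suc (j + K)))))"
    proof (rule summable_comparison_test'[where N = 0])
      fix j
      have "sqrt (28 * M * (del (j + K) + del (Suc (j + K))))
          = sqrt (28 * M) * sqrt (del (j + K) + del (Suc (j + K)))"
        by (rule real_sqrt_mult)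
      also have "\<dots> \<le> sqrt (28 * M) * (sqrt (del (j + K)) + sqrt (del (Suc (j + K))))"
        using M del(1) by (intro mult_left_mono sqrt_add_le_add_sqrt) auto
      finally show "norm (sqrt (28 * M * (del (j + K) + del (Suc (j + K)))))
          \<le> sqrt (28 * M) * (sqrt (del (j + K)) + sqrt (del (Suc (j + K))))"
        using M del(1) by simp
    qed
    show "\<exists>k\<ge>n. dist (z (k + K)) zb < \<epsilon>" if \<epsilon>: "0 < \<epsilon>" for \<epsilon> n
    proof -
      obtain j0 where j0: "\<And>j. j0 \<le> j \<Longrightarrow> dist (z (s j)) zb < \<epsilon>"
        using metric_LIMSEQ_D[OF s(2) \<epsilon>] by blast
      define j where "j = max j0 (n + K)"
      have "n + K \<le> s j"
        using seq_suble[OF s(1), of j] by (simp add: j_def)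
      then show ?thesis
        using j0[of j] by (intro exI[of _ "s j - K"]) (simp add: j_def)
    qed
  qed
  then have z_conv: "z \<longlonglongrightarrow> zb"
    by (rule LIMSEQ_offset)

  \<comment> \<open>Criticality of the limit\<close>
  have grad0: "(\<lambda>k. grad_P (Suc (Suc k))) \<longlonglongrightarrow> 0"
  proof (rule Lim_null_comparison)
    have "eventually (\<lambda>k. dist (z k) zb \<le> \<rho>) sequentially"
      using tendstoD[OF z_conv \<rho>\<eta>(1)] by (rule eventually_mono) simp
    then obtain n where n: "\<And>k. n \<le> k \<Longrightarrow> dist (z k) zb \<le> \<rho>"
      by (auto simp: eventually_sequentially)
    show "eventually (\<lambda>k. norm (grad_P (Suc (Suc k)))
        \<le> C * (dist (z (Suc (Suc k))) (z (Suc k)) + dist (z (Suc k)) (z k))) sequentially"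
      using eventually_ge_at_top[of "max n N"]
    proof eventually_elim
      case (elim k)
      then show ?case using grad_le[of "Suc k"] n by simp
    qed
    have "(\<lambda>k. C * (dist (z (Suc (Suc k))) (z (Suc k)) + dist (z (Suc k)) (z k)))
        \<longlonglongrightarrow> C * (dist zb zb + dist zb zb)"
      by (intro tendsto_mult_left tendsto_add tendsto_dist LIMSEQ_Suc z_conv)
    then show "(\<lambda>k. C * (dist (z (Suc (Suc k))) (z (Suc k)) + dist (z (Suc k)) (z k))) \<longlonglongrightarrow> 0"
      by simp
  qed
  have gU: "(\<lambda>k. grad_U F (U k) (V k)) \<longlonglongrightarrow> grad_U F Ub Vb"
    using lipschitz_on_cball_tendsto[OF C1 _ z_conv] \<rho>\<eta> by (simp add: zb_def)
  have gV: "(\<lambda>k. grad_V F (U k) (V k)) \<longlonglongrightarrow> grad_V F Ub Vb"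
    using lipschitz_on_cball_tendsto[OF C2 _ z_conv] \<rho>\<eta> by (simp add: zb_def)
  define pU pV where "pU w k = pen_grad w q (U (Suc (Suc k)))" and "pV w k = pen_grad w p (V (Suc (Suc k)))"
    for w k
  txt \<open>For an exponent below \<open>1\<close> the penalty gradient could blow up if a column tended to \<open>0\<close>. It does not,
    because it differs from the vanishing gradient of the perturbed objective only by the
    convergent gradient of the smooth part.\<close>
  have pU: "(\<lambda>k. pU (lam1 (Suc k)) k) \<longlonglongrightarrow> - grad_U F Ub Vb"
    using tendsto_diff[OF tendsto_fst[OF grad0] LIMSEQ_Suc[OF LIMSEQ_Suc[OF gU]]]
    by (simp add: grad_P_def pU_def)
  have pV: "(\<lambda>k. pV (lam2 (Suc k)) k) \<longlonglongrightarrow> - grad_V F Ub Vb"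
    using tendsto_diff[OF tendsto_snd[OF grad0] LIMSEQ_Suc[OF LIMSEQ_Suc[OF gV]]]
    by (simp add: grad_P_def pV_def)
  have null: "(\<lambda>k. 14 * del (Suc k) * norm (x k)) \<longlonglongrightarrow> 0" if "x \<longlonglongrightarrow> a"
    for x :: "nat \<Rightarrow> 'e::real_normed_vector" and a
    using tendsto_mult[OF tendsto_mult_left[OF LIMSEQ_Suc[OF del(3)], of 14] tendsto_norm[OF that]]
    by simp
  have close: "\<bar>lam1 (Suc k) t - lam0\<bar> \<le> 14 * del (Suc k) * lam1 (Suc k) t"
    "\<bar>lam2 (Suc k) t - lam0\<bar> \<le> 14 * del (Suc k) * lam2 (Suc k) t" if "K \<le> k" for k t
  proof -
    have Suc: "N \<le> Suc k" "lam (Suc k) = lam0"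
      using KN[OF that] K(1) that by auto
    note w = weights_close[OF Suc]
    have "7 * del (Suc k) * lam0 \<le> 14 * del (Suc k) * x" if "lam0 / 2 \<le> x" for x
      using mult_left_mono[OF that, of "14 * del (Suc k)"] del(1) by simp
    with w show "\<bar>lam1 (Suc k) t - lam0\<bar> \<le> 14 * del (Suc k) * lam1 (Suc k) t"
      "\<bar>lam2 (Suc k) t - lam0\<bar> \<le> 14 * del (Suc k) * lam2 (Suc k) t"
      by (meson order_trans)+
  qed
  \<comment> \<open>The perturbed penalty gradients converge and are therefore bounded; a vanishing
    relative error then makes the weights replaceable by \<open>lam0\<close>.\<close>
  have dU: "(\<lambda>k. pU (lam1 (Suc k)) k - pU (\<lambda>_. lam0) k) \<longlonglongrightarrow> 0"
    using null[OF pU]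
  proof (rule Lim_null_comparison[rotated])
    show "eventually (\<lambda>k. norm (pU (lam1 (Suc k)) k - pU (\<lambda>_. lam0) k)
        \<le> 14 * del (Suc k) * norm (pU (lam1 (Suc k)) k)) sequentially"
      using eventually_ge_at_top[of K] unfolding pU_def
      by eventually_elim (intro norm_pen_grad_diff_le close; simp add: del(1))
  qed
  have dV: "(\<lambda>k. pV (lam2 (Suc k)) k - pV (\<lambda>_. lam0) k) \<longlonglongrightarrow> 0"
    using null[OF pV]
  proof (rule Lim_null_comparison[rotated])
    show "eventually (\<lambda>k. norm (pV (lam2 (Suc k)) k - pV (\<lambda>_. lam0) k)
        \<le> 14 * del (Suc k) * norm (pV (lam2 (Suc k)) k)) sequentially"
      using eventually_ge_at_top[of K] unfolding pV_def
      by eventually_elim (intro norm_pen_grad_diff_le close; simp add: del(1))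
  qed
  define G where "G k = (grad_U F (U k) (V k) + pen_grad (\<lambda>_. lam0) q (U k),
                         grad_V F (U k) (V k) + pen_grad (\<lambda>_. lam0) p (V k))" for k
  have "(\<lambda>k. G (Suc (Suc k))) \<longlonglongrightarrow> 0"
    using tendsto_diff[OF grad0 tendsto_Pair[OF dU dV]]
    by (simp add: G_def grad_P_def pU_def pV_def zero_prod_def)
  then have G0: "(\<lambda>k. G (k + Suc N)) \<longlonglongrightarrow> 0"
    by (intro LIMSEQ_ignore_initial_segment) (blast intro: LIMSEQ_imp_Suc)
  \<comment> \<open>The limit may have zero columns, where the penalty need not be differentiable.
    The gradients \<open>G\<close> at the iterates witness the limiting subdifferential; the shift
    by \<open>Suc N\<close> ensures nonzero columns at every index.\<close>
  have "critical_point (Phi F q p lam0) zb"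
    unfolding critical_point_def limiting_subdiff_def
  proof (intro CollectI exI conjI allI)
    show "(\<lambda>k. z (k + Suc N)) \<longlonglongrightarrow> zb"
      using z_conv by (rule LIMSEQ_ignore_initial_segment)
    then show "(\<lambda>k. Phi F q p lam0 (z (k + Suc N))) \<longlonglongrightarrow> Phi F q p lam0 zb"
      unfolding Phi_eq_Phi_weighted zb_def using F_diff qp
      by (intro tendsto_Phi_weighted) auto
    show "G (k + Suc N) \<in> frechet_subdiff (Phi F q p lam0) (z (k + Suc N))" for k
      unfolding Phi_eq_Phi_weighted G_def using F_diff qp columns_nonzero[of "k + Suc N"]
      by (intro GDERIV_in_limiting_subdiff(1) GDERIV_Phi_weighted) auto
    show "(\<lambda>k. G (k + Suc N)) \<longlonglongrightarrow> 0" by (rule G0)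
  qed
  then show ?thesis
    using z_conv by (simp add: zb_def)
qed

end
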